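(* Let $i,j\ge1$ be integers with $N:=i+j$ even and put $R(i,j):=\binom{N}{i}\beta_N r_N$. Then the values $\left\langle R(i,j)\,q^{N-2}\,s_{ij}(p,q)\right\rangle$, for $0<p<q$ with $\gcd(p,q)=1$, are equidistributed in $[0,1)$ in the following sense: for every nonzero integer $m$, $$\lim_{x\to\infty}\frac{1}{\#\{(p,q):\gcd(p,q)=1,\ 0<p<q\le x\}}\sum_{0<q<x}\ \sum_{\substack{0<p<q\\ \gcd(p,q)=1}}\exp\!\big(2\pi i\, m\,R(i,j)\,q^{N-2}s_{ij}(p,q)\big)=0 .$$
   Context: Bernoulli numbers $B_k$: $\frac{z}{e^z-1}=\sum_{k\ge0}\frac{B_k}{k!}z^k$; Bernoulli polynomials: $\frac{ze^{xz}}{e^z-1}=\sum_k\frac{B_k(x)}{k!}z^k$. $\langle x\rangle=x-\lfloor x\rfloor$. Periodic Bernoulli function: $\bar B_k(x)=B_k(\langle x\rangle)$ for $x\notin\mathbb Z$; $\bar B_k(x)=B_k$ for $k\ge2$, $x\in\mathbb Z$; $\bar B_1(x)=0$ for $x\in\mathbb Z$. Generalized Dedekind sum: $s_{ij}(p,q)=\sum_{k=0}^{q-1}\bar B_i(k/q)\bar B_j(pk/q)$. For even $N$, $B_N=\alpha_N/\beta_N$ in lowest terms with $\beta_N>0$; $r_N$ is the lcm of the denominators of $\beta_N\binom{N}{i+1}B_{i+1}B_{N-i-1}$ over odd $i$ with $0\le i\le N-2$ (empty lcm $=1$). *)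

theory Defs
  imports "HOL-Analysis.Analysis" "HOL-Computational_Algebra.Formal_Power_Series"
begin

definition bernoulli :: "nat \<Rightarrow> rat" where
  "bernoulli k = fact k * fps_nth (fps_X / (fps_exp 1 - 1)) k"

definition bernoulli_poly :: "nat \<Rightarrow> real \<Rightarrow> real" where
  "bernoulli_poly k x = fact k * fps_nth (fps_X * fps_exp x / (fps_exp 1 - 1)) k"

definition periodic_bernoulli :: "nat \<Rightarrow> real \<Rightarrow> real" where
  "periodic_bernoulli k x =
     (if x \<notin> \<int> then bernoulli_poly k (frac x)
      else if k = 1 then 0
      else of_rat (bernoulli k))"

definition dedekind_sum :: "nat \<Rightarrow> nat \<Rightarrow> nat \<Rightarrow> nat \<Rightarrow> real" where
  "dedekind_sum i j p q =
     (\<Sum>k<q. periodic_bernoulli i (real k / real q) *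
             periodic_bernoulli j (real p * real k / real q))"

text \<open>\<^const>\<open>quotient_of\<close> yields the representation in lowest terms with positive denominator.\<close>

definition rat_denom :: "rat \<Rightarrow> int" where
  "rat_denom x = snd (quotient_of x)"

definition bernoulli_denom :: "nat \<Rightarrow> int" where
  "bernoulli_denom N = rat_denom (bernoulli N)"

definition r_lcm :: "nat \<Rightarrow> int" where
  "r_lcm N = Lcm {rat_denom (of_int (bernoulli_denom N) * of_nat (N choose (i + 1)) *
                     bernoulli (i + 1) * bernoulli (N - i - 1)) | i. odd i \<and> i \<le> N - 2}"

definition R_const :: "nat \<Rightarrow> nat \<Rightarrow> int" where
  "R_const i j = int ((i + j) choose i) * bernoulli_denom (i + j) * r_lcm (i + j)"

end

theory Submission
  imports Defs "HOL-Number_Theory.Modular_Inverse" "HOL-Computational_Algebra.Squarefree" "HOL-Computational_Algebra.Polynomial"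
    "HOL-Library.Real_Mod"
begin

text \<open>
  Write \<open>N = i + j\<close> and \<open>U\<^sub>i(p,q) = \<beta>\<^sub>N r\<^sub>N C(N,i) q\<^bsup>N-1\<^esup> s\<^sub>i\<^sub>j(p,q)\<close>, so that the quantity to be equidistributed is
  \<open>U\<^sub>i(p,q) / q\<close>. The addition theorem of the hyperbolic cotangent, summed over a lattice of arguments,
  yields a reciprocity law between the sums for \<open>(p,q)\<close> and those for \<open>(q,p)\<close>. By induction on \<open>q\<close> it
  shows that all \<open>U\<^sub>i(p,q)\<close> are integers, and modulo \<open>q\<close> it reduces to
  \<open>U\<^sub>i(p,q) \<equiv> r\<^sub>N \<alpha>\<^sub>N (C(N-1,i) p\<^bsup>-i\<^esup> + C(N-1,j) p\<^bsup>j\<^esup>)\<close>, where \<open>\<alpha>\<^sub>N \<noteq> 0\<close>.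

  The exponential sum over \<open>p\<close> is therefore of Kloosterman type. If a prime \<open>l\<close> divides \<open>q\<close> exactly once,
  the sum splits off a factor modulo \<open>l\<close>, and Kloosterman's fourth moment argument bounds this factor by
  \<open>O(l\<^bsup>3/4\<^esup>)\<close>. The numbers \<open>q\<close> without a large prime factor of this kind have density zero, so no
  bound for prime power moduli and no appeal to Weil's theorem is needed.
\<close>

section \<open>Periodic Bernoulli functions\<close>

unbundle no vec_syntax
unbundle fps_syntax

text \<open>The constants are forced by the case \<open>q = 1\<close>, where the sum is a product of
  two Bernoulli numbers: \<open>r_N\<close> clears the denominators of
  \<open>\<beta>_N C(N,k) B_k B_(N-k)\<close>, and the same products are the coefficients of the
  reciprocity law. That law holds identically in a free variable \<open>x\<close>, so comparing
  coefficients isolates each single \<open>i\<close>. Two obstacles shape the arithmetic part: the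
  law carries a factor \<open>x + 1\<close>, which must be divided out without creating
  denominators, and it controls only \<open>p^i U_i(p,q)\<close>, so that powers of \<open>p\<close>
  might remain in the denominator of \<open>U_i(p,q)\<close>. The small saving
  \<open>l^(-1/4)\<close> is enough for the following reason. The trivial bound \<open>q\<close> for
  the sum over \<open>p\<close> adds up to the order \<open>x^2\<close>, which is also the order of
  the number of pairs. Hence a relative saving \<open>\<epsilon>\<close> for all \<open>q\<close>
  outside a set of density zero suffices, and every exact prime factor \<open>l\<close> beyond a
  bound depending on \<open>\<epsilon>\<close> provides it.\<close>

lemma sum_affine_residues:
  fixes f :: "int \<Rightarrow> 'a::comm_monoid_add"
  assumes q: "q > 0" and cop: "coprime a (int q)" and per: "\<And>x. f (x mod int q) = f x"
  shows "(\<Sum>k<q. f (a * int k + b)) = (\<Sum>k<q. f (int k))"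
proof -
  define g where "g = (\<lambda>k::nat. nat ((a * int k + b) mod int q))"
  have g: "int (g k) = (a * int k + b) mod int q" for k
    using q by (simp add: g_def)
  have "inj_on g {..<q}"
  proof (rule inj_onI)
    fix x y assume xy: "x \<in> {..<q}" "y \<in> {..<q}" "g x = g y"
    then have "[a * int x + b = a * int y + b] (mod int q)"
      unfolding cong_def by (metis g)
    then have "[int x = int y] (mod int q)"
      using cop by (simp add: cong_add_rcancel cong_mult_lcancel)
    with xy show "x = y"
      by (simp add: cong_int_iff cong_less_modulus_unique_nat)
  qed
  moreover have "g ` {..<q} \<subseteq> {..<q}"
  proof
    fix y assume "y \<in> g ` {..<q}"
    then obtain k where "y = g k" by auto
    then have "int y < int q" using g[of k] q by simp
    then show "y \<in> {..<q}" by simp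
  qed
  ultimately have "bij_betw g {..<q} {..<q}"
    by (simp add: bij_betw_def endo_inj_surj)
  then have "(\<Sum>k<q. f (int k)) = (\<Sum>k<q. f (int (g k)))"
    by (rule sum.reindex_bij_betw[symmetric])
  also have "\<dots> = (\<Sum>k<q. f (a * int k + b))"
    by (simp add: g per)
  finally show ?thesis ..
qed

section \<open>Bernoulli numbers and their generating series\<close>

lemma fps_exp_minus_1_nonzero: "c \<noteq> 0 \<Longrightarrow> fps_exp c - 1 \<noteq> (0::'a::field_char_0 fps)"
proof
  assume "c \<noteq> 0" "fps_exp c - 1 = (0::'a fps)"
  then have "(fps_exp c - 1) $ 1 = (0 :: 'a)" by simp
  then show False using \<open>c \<noteq> 0\<close> by simp
qed

text \<open>Division of power series is a total operation; it is exact here because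
  \<open>fps_exp 1 - 1\<close> has subdegree 1 and therefore divides \<open>fps_X\<close>.\<close>

lemma fps_X_divide_exp_minus_1:
  fixes f :: "'a::field_char_0 fps"
  shows "fps_X * f / (fps_exp 1 - 1) * (fps_exp 1 - 1) = fps_X * f"
proof -
  have "subdegree (fps_exp 1 - 1 :: 'a fps) = 1"
    by (rule subdegreeI) auto
  then have "fps_exp 1 - 1 dvd (fps_X :: 'a fps)"
    by (subst fps_dvd_iff) (auto simp: fps_exp_minus_1_nonzero)
  then show ?thesis by simp
qed

text \<open>Embedding the coefficients of the rational series into the reals yields a solution of
  \<open>g * (fps_exp 1 - 1) = fps_X\<close>, which has only one. This links the rational numbers
  that carry the denominators to the real-valued polynomials.\<close>

lemma of_rat_bernoulli: "of_rat (bernoulli k) = bernoulli_poly k 0"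
proof -
  define b :: "rat fps" where "b = fps_X / (fps_exp 1 - 1)"
  define g :: "real fps" where "g = fps_X / (fps_exp 1 - 1)"
  define h where "h = Abs_fps (\<lambda>n. of_rat (b $ n) :: real)"
  have b: "b * (fps_exp 1 - 1) = fps_X"
    using fps_X_divide_exp_minus_1[of "1 :: rat fps"] by (simp add: b_def)
  have g: "g * (fps_exp 1 - 1) = fps_X"
    using fps_X_divide_exp_minus_1[of "1 :: real fps"] by (simp add: g_def)
  have fact: "of_rat (fact n) = (fact n :: real)" for n
    by (metis of_nat_fact of_rat_of_nat_eq)
  have "h * (fps_exp 1 - 1) = fps_X"
  proof (rule fps_ext)
    fix n
    have "(h * (fps_exp 1 - 1)) $ n = of_rat ((b * (fps_exp 1 - 1)) $ n)"
      unfolding fps_mult_nth of_rat_sum h_def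
      by (rule sum.cong)
        (auto simp: of_rat_mult of_rat_diff of_rat_divide of_rat_inverse fact)
    then show "(h * (fps_exp 1 - 1)) $ n = fps_X $ n"
      by (simp add: b)
  qed
  with g have "h = g"
    by (metis fps_exp_minus_1_nonzero mult_right_cancel one_neq_zero)
  then have "of_rat (b $ k) = g $ k" by (auto simp: h_def fps_eq_iff)
  then show ?thesis
    by (simp add: bernoulli_def bernoulli_poly_def of_rat_mult b_def g_def fact)
qed

lemma bernoulli_recurrence:
  "(\<Sum>k\<le>n. of_nat (Suc n choose k) * bernoulli k) = (if n = 0 then 1 else 0)"
proof -
  define b :: "rat fps" where "b = fps_X / (fps_exp 1 - 1)"
  have b: "b * (fps_exp 1 - 1) = fps_X"
    using fps_X_divide_exp_minus_1[of "1 :: rat fps"] by (simp add: b_def)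
  have "of_nat (Suc n choose k) * bernoulli k = fact (Suc n) * (b $ k * (fps_exp 1 - 1) $ (Suc n - k))"
    if "k \<le> n" for k
    using that by (simp add: bernoulli_def b_def binomial_fact)
  then have "(\<Sum>k\<le>n. of_nat (Suc n choose k) * bernoulli k)
      = (\<Sum>k\<le>n. fact (Suc n) * (b $ k * (fps_exp 1 - 1) $ (Suc n - k)))"
    by (intro sum.cong) auto
  \<comment> \<open>The added term is 0, because \<open>fps_exp 1 - 1\<close> has constant
    coefficient 0.\<close>
  also have "\<dots> = (\<Sum>k\<le>Suc n. fact (Suc n) * (b $ k * (fps_exp 1 - 1) $ (Suc n - k)))"
    by simp
  also have "\<dots> = fact (Suc n) * (b * (fps_exp 1 - 1)) $ Suc n"
    by (simp add: fps_mult_nth sum_distrib_left atLeast0AtMost del: sum.atMost_Suc)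
  also have "\<dots> = (if n = 0 then 1 else 0)"
    by (simp add: b)
  finally show ?thesis .
qed

lemma bernoulli_0 [simp]: "bernoulli 0 = 1"
  using bernoulli_recurrence[of 0] by simp

lemma bernoulli_1: "bernoulli (Suc 0) = -1/2"
  using bernoulli_recurrence[of 1] by simp

lemma bernoulli_2: "bernoulli 2 = 1/6"
  using bernoulli_recurrence[of 2] by (simp add: numeral_2_eq_2 bernoulli_1)

text \<open>After division by \<open>c t\<close> this is \<open>e\<^bsup>c t \<langle>x\<rangle>\<^esup> / (e\<^bsup>c t\<^esup> - 1)\<close> if \<open>x\<close> is not an integer; the convention
  for \<open>k = 1\<close> at the integers turns it into \<open>coth (c t / 2) / 2\<close> there.\<close>

definition bgf :: "real \<Rightarrow> real \<Rightarrow> real fps" where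
  "bgf x c = Abs_fps (\<lambda>n. c ^ n * periodic_bernoulli n x / fact n)"

lemma bgf_nth: "bgf x c $ n = c ^ n * periodic_bernoulli n x / fact n"
  by (simp add: bgf_def)

lemma fps_exp_scale: "fps_exp x oo (fps_const c * fps_X) = fps_exp (c * x :: real)"
  by (rule fps_ext) (simp add: fps_nth_compose_linear power_mult_distrib)

lemma bgf_nonint:
  assumes "x \<notin> \<int>"
  shows "bgf x c * (fps_exp c - 1) = fps_const c * fps_X * fps_exp (c * frac x)"
proof -
  define g where "g = fps_X * fps_exp (frac x) / (fps_exp 1 - 1 :: real fps)"
  have "bgf x c = g oo (fps_const c * fps_X)"
    using assms
    by (intro fps_ext)
      (simp add: bgf_def fps_nth_compose_linear periodic_bernoulli_def bernoulli_poly_def g_def)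
  moreover have "fps_exp c - 1 = (fps_exp 1 - 1) oo (fps_const c * fps_X :: real fps)"
    by (simp add: fps_compose_sub_distrib fps_exp_scale)
  ultimately have "bgf x c * (fps_exp c - 1) = (g * (fps_exp 1 - 1)) oo (fps_const c * fps_X)"
    by (simp add: fps_compose_mult_distrib)
  also have "\<dots> = (fps_X * fps_exp (frac x)) oo (fps_const c * fps_X)"
    by (simp add: g_def fps_X_divide_exp_minus_1)
  also have "\<dots> = fps_const c * fps_X * fps_exp (c * frac x)"
    by (simp add: fps_compose_mult_distrib fps_exp_scale)
  finally show ?thesis .
qed

text \<open>Replacing \<open>B_1 = -1/2\<close> by 0 adds \<open>t/2\<close> to
  \<open>t / (e^t - 1)\<close> and produces the even function
  \<open>t/2 * (e^t + 1) / (e^t - 1)\<close>.\<close>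

lemma bgf_int:
  assumes "x \<in> \<int>"
  shows "bgf x c * (fps_exp c - 1) = fps_const (c / 2) * fps_X * (fps_exp c + 1)"
proof -
  define g where "g = fps_X / (fps_exp 1 - 1 :: real fps)"
  have g: "g * (fps_exp 1 - 1) = fps_X"
    using fps_X_divide_exp_minus_1[of "1 :: real fps"] by (simp add: g_def)
  have "periodic_bernoulli n x / fact n = (g + fps_const (1/2) * fps_X) $ n" for n
  proof (cases "n = 1")
    case True
    have "g $ 1 = -1/2"
      using bernoulli_1 of_rat_bernoulli[of 1] 
      by (simp add: bernoulli_poly_def g_def of_rat_minus of_rat_divide)
    then show ?thesis using True assms by (simp add: periodic_bernoulli_def)
  next
    case False
    then show ?thesis using assms
      by (simp add: periodic_bernoulli_def of_rat_bernoulli bernoulli_poly_def g_def)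
  qed
  then have "bgf x c = (g + fps_const (1/2) * fps_X) oo (fps_const c * fps_X)"
    by (intro fps_ext) (simp only: bgf_nth fps_nth_compose_linear times_divide_eq_right[symmetric])
  moreover have "fps_exp c - 1 = (fps_exp 1 - 1) oo (fps_const c * fps_X :: real fps)"
    by (simp add: fps_compose_sub_distrib fps_exp_scale)
  ultimately have "bgf x c * (fps_exp c - 1)
      = ((g + fps_const (1/2) * fps_X) * (fps_exp 1 - 1)) oo (fps_const c * fps_X)"
    by (simp add: fps_compose_mult_distrib)
  also have "(g + fps_const (1/2) * fps_X) * (fps_exp 1 - 1) = fps_const (1/2) * fps_X * (fps_exp 1 + 1)"
  proof -
    have "fps_X = fps_const (1/2) * fps_X + fps_const (1/2) * (fps_X :: real fps)"
      by (simp flip: distrib_right)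
    then show ?thesis using g by (simp add: algebra_simps)
  qed
  also have "\<dots> oo (fps_const c * fps_X) = fps_const (1/2) * (fps_const c * fps_X) * (fps_exp c + 1)"
    by (simp add: fps_compose_mult_distrib fps_compose_add_distrib fps_exp_scale)
  also have "\<dots> = fps_const (c / 2) * fps_X * (fps_exp c + 1)"
    by (simp flip: mult.assoc)
  finally show ?thesis .
qed

lemma fps_exp_cancel:
  assumes "c \<noteq> 0" "f * (fps_exp c - 1) = g * (fps_exp c - 1 :: real fps)"
  shows "f = g"
  using assms fps_exp_minus_1_nonzero by (metis mult_right_cancel)

section \<open>Functional equations of the generating series\<close>

lemma periodic_bernoulli_shift: "periodic_bernoulli k (x + of_int n) = periodic_bernoulli k x"
  by (simp add: periodic_bernoulli_def frac_def)

lemma bgf_mod: "bgf (x + of_int n) c = bgf x c"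
  by (simp add: bgf_def periodic_bernoulli_shift)

text \<open>Multiplication by \<open>fps_exp c\<close> turns \<open>fps_exp (-c) - 1\<close> into
  \<open>-(fps_exp c - 1)\<close>. Off the integers \<open>frac (-x) = 1 - frac x\<close> matches
  the numerators; at the integers they match because of the value 0 chosen for
  \<open>k = 1\<close>.\<close>

lemma bgf_reflect:
  assumes "c \<noteq> 0"
  shows "bgf (-x) (-c) = bgf x c"
proof (rule fps_exp_cancel[OF assms])
  define E where "E = fps_exp c"
  define F where "F = fps_exp (-c)"
  have EF: "E * F = 1" by (simp add: E_def F_def flip: fps_exp_add_mult)
  have *: "bgf (-x) (-c) * (E - 1) = - (E * (bgf (-x) (-c) * (F - 1)))"
  proof -
    have "- (E * (bgf (-x) (-c) * (F - 1))) = bgf (-x) (-c) * (E - E * F)"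
      by (simp add: algebra_simps)
    then show ?thesis by (simp add: EF)
  qed
  show "bgf (-x) (-c) * (fps_exp c - 1) = bgf x c * (fps_exp c - 1)"
  proof (cases "x \<in> \<int>")
    case True
    have "- (E * (bgf (-x) (-c) * (F - 1))) = fps_const (c/2) * fps_X * (E * F + E)"
    proof -
      have "bgf (-x) (-c) * (F - 1) = - (fps_const (c/2) * fps_X * (F + 1))"
        using True bgf_int[of "-x" "-c"] by (simp add: F_def flip: fps_const_neg)
      then show ?thesis by (simp only:) (simp add: algebra_simps)
    qed
    then show ?thesis using True * EF by (simp add: bgf_int E_def add.commute)
  next
    case False
    have "c + - (c * (1 - frac x)) = c * frac x" by (simp add: algebra_simps)
    then have "E * fps_exp (- (c * (1 - frac x))) = fps_exp (c * frac x)"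
      by (simp add: E_def flip: fps_exp_add_mult)
    moreover have "- (E * (bgf (-x) (-c) * (F - 1)))
        = fps_const c * fps_X * (E * fps_exp (- (c * (1 - frac x))))"
      using False by (simp add: bgf_nonint F_def frac_neg flip: fps_const_neg)
    ultimately show ?thesis using False * by (simp add: bgf_nonint E_def)
  qed
qed

lemma periodic_bernoulli_reflect: "periodic_bernoulli k (-x) = (-1) ^ k * periodic_bernoulli k x"
proof -
  have "bgf (-x) (-1) $ k = bgf x 1 $ k" using bgf_reflect[of 1 x] by simp
  then have "(-1) ^ k * periodic_bernoulli k (-x) = periodic_bernoulli k x"
    by (simp add: bgf_nth divide_simps)
  then have "(-1) ^ k * ((-1) ^ k * periodic_bernoulli k (-x)) = (-1) ^ k * periodic_bernoulli k x"
    by simp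
  then show ?thesis by (simp flip: mult.assoc power_add)
qed

text \<open>Raabe's multiplication theorem in all degrees at once: over the common denominator
  \<open>fps_exp c - 1\<close> the numerators form a geometric series in
  \<open>fps_exp (c / p)\<close>.\<close>

lemma bgf_distribution:
  assumes "p > 0" "c \<noteq> 0"
  shows "(\<Sum>k<p. bgf (x + real k / real p) c) = of_nat p * bgf (real p * x) (c / real p)"
proof -
  define n where "n = \<lfloor>real p * x\<rfloor>"
  define y where "y = frac (real p * x)"
  have y: "0 \<le> y" "y < 1" by (auto simp: y_def frac_lt_1)
  have xny: "real p * x = y + of_int n" by (simp add: y_def n_def frac_def)
  have x: "x = y / p + of_int n / p"
    using assms xny by (simp add: field_simps)
  define E where "E = fps_exp (c / p)"
  have Ek: "fps_exp (c * (real k / real p)) = E ^ k" for k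
    by (simp add: E_def fps_exp_power_mult)
  have Ep: "fps_exp c = E ^ p" using assms by (simp add: E_def fps_exp_power_mult)
  \<comment> \<open>With \<open>x = (y + n) / p\<close> the shift by \<open>n\<close> only permutes
    the residues modulo \<open>p\<close>, so \<open>x\<close> may be replaced by
    \<open>y / p\<close> with \<open>0 \<le> y < 1\<close>.\<close>
  have "(\<Sum>k<p. bgf (x + real k / real p) c)
      = (\<Sum>k<p. (\<lambda>m::int. bgf (y / p + of_int m / p) c) (1 * int k + n))"
    by (simp add: x add_divide_distrib algebra_simps)
  also have "\<dots> = (\<Sum>k<p. bgf (y / p + of_int (int k) / p) c)"
  proof (rule sum_affine_residues)
    fix m :: int
    have "m = m mod int p + int p * (m div int p)" by simp
    then have "real_of_int m = of_int (m mod int p) + real p * of_int (m div int p)"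
      by (metis of_int_add of_int_mult of_int_of_nat_eq)
    then have "y / p + of_int m / p = y / p + of_int (m mod int p) / p + of_int (m div int p)"
      using assms by (simp add: field_simps)
    then show "bgf (y / p + of_int (m mod int p) / p) c = bgf (y / p + of_int m / p) c"
      by (simp only: bgf_mod)
  qed (use assms in auto)
  finally have sum: "(\<Sum>k<p. bgf (x + real k / real p) c) = (\<Sum>k<p. bgf ((y + real k) / p) c)"
    by (simp add: add_divide_distrib)
  have rhs: "bgf (real p * x) (c / real p) = bgf y (c / real p)"
    by (simp add: xny bgf_mod)
  have lt: "0 \<le> (y + real k) / p" "(y + real k) / p < 1" if "k < p" for k
    using that y assms by (auto simp: divide_simps)
  have fr: "frac ((y + real k) / p) = (y + real k) / p" if "k < p" for k
    using lt[OF that] by (simp add: frac_eq)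
  have pc: "of_nat p * fps_const (c / p) = fps_const c"
    using assms by (simp flip: fps_of_nat)
  have geo: "(\<Sum>k<p. E ^ k) * (E - 1) = E ^ p - 1"
    by (metis lessThan_atLeast0 mult.commute power_diff_1_eq)
  show ?thesis unfolding sum rhs
  proof (rule fps_exp_cancel[of "c / real p"], use assms in simp, rule fps_exp_cancel[OF assms(2)])
    show "(\<Sum>k<p. bgf ((y + real k) / real p) c) * (fps_exp (c / real p) - 1) * (fps_exp c - 1) =
          of_nat p * bgf y (c / real p) * (fps_exp (c / real p) - 1) * (fps_exp c - 1)"
    proof (cases "y = 0")
      case False
      have ynot: "y \<notin> \<int>" using False y frac_eq[of y] frac_eq_0_iff[of y] by auto
      have nonint: "(y + real k) / p \<notin> \<int>" if "k < p" for k
        using fr[OF that] False y assms frac_eq_0_iff[of "(y + real k) / p"]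
        by (auto simp: add_nonneg_eq_0_iff)
      have "(\<Sum>k<p. bgf ((y + real k) / real p) c) * (fps_exp c - 1)
          = (\<Sum>k<p. fps_const c * fps_X * fps_exp (c * ((y + real k) / p)))"
        unfolding sum_distrib_right by (intro sum.cong) (auto simp: bgf_nonint nonint fr)
      also have "\<dots> = fps_const c * fps_X * fps_exp (c * (y / p)) * (\<Sum>k<p. E ^ k)"
        unfolding sum_distrib_left Ek[symmetric]
        by (intro sum.cong)
          (auto simp: add_divide_distrib distrib_left fps_exp_add_mult simp del: times_divide_eq_right)
      finally have "(\<Sum>k<p. bgf ((y + real k) / real p) c) * (fps_exp c - 1) * (E - 1)
          = fps_const c * fps_X * fps_exp (c * (y / p)) * (E ^ p - 1)"
        by (simp add: mult.assoc geo)
      moreover have "of_nat p * bgf y (c / real p) * (E - 1)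
          = fps_const c * fps_X * fps_exp (c * (y / p))"
        using ynot y by (simp add: mult.assoc E_def bgf_nonint frac_eq[THEN iffD2] flip: pc)
      ultimately show ?thesis
        by (simp add: Ep mult_ac flip: E_def)
    next
      case True
      \<comment> \<open>Now \<open>k = 0\<close> is the only integral argument. Its numerator
        \<open>(E^p + 1) / 2\<close> in place of 1 is matched by \<open>(E + 1) / 2\<close> on the
        right.\<close>
      have nonint: "real k / p \<notin> \<int>" if "k < p" "k \<noteq> 0" for k
        using fr[OF that(1)] that assms frac_eq_0_iff[of "real k / p"] by (auto simp: True)
      have split: "{..<p} = insert 0 {1..<p}" using assms by auto
      have "(\<Sum>k<p. bgf ((y + real k) / real p) c) * (fps_exp c - 1)
          = bgf 0 c * (fps_exp c - 1) + (\<Sum>k\<in>{1..<p}. bgf (real k / real p) c * (fps_exp c - 1))"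
        by (simp add: split True sum_distrib_right distrib_right)
      also have "(\<Sum>k\<in>{1..<p}. bgf (real k / real p) c * (fps_exp c - 1))
          = (\<Sum>k\<in>{1..<p}. fps_const c * fps_X * E ^ k)"
        using fr by (intro sum.cong) (auto simp: bgf_nonint nonint True simp flip: Ek)
      also have "\<dots> = fps_const c * fps_X * ((\<Sum>k<p. E ^ k) - 1)"
        by (simp add: split sum_distrib_left)
      also have "bgf 0 c * (fps_exp c - 1) = fps_const (c/2) * fps_X * (E ^ p + 1)"
        by (simp add: bgf_int flip: Ep)
      finally have 1: "(\<Sum>k<p. bgf ((y + real k) / real p) c) * (fps_exp c - 1)
         = fps_const (c/2) * fps_X * (E ^ p + 1) + fps_const c * fps_X * ((\<Sum>k<p. E ^ k) - 1)" .
      have half: "fps_const c = 2 * fps_const (c / 2)"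
        by (simp add: numeral_fps_const)
      have 2: "of_nat p * bgf y (c / real p) * (E - 1) = fps_const (c/2) * fps_X * (E + 1)"
      proof -
        have "of_nat p * fps_const (c / real p / 2) = fps_const (c/2)"
          using assms by (simp flip: fps_of_nat)
        then show ?thesis
          by (simp add: mult.assoc E_def bgf_int True)
      qed
      have "(\<Sum>k<p. bgf ((y + real k) / real p) c) * (fps_exp c - 1) * (E - 1)
        = fps_const (c/2) * fps_X * ((E ^ p + 1) * (E - 1) + 2 * ((\<Sum>k<p. E ^ k) * (E - 1)) - 2 * (E - 1))"
        unfolding 1 half by (simp add: algebra_simps)
      also have "\<dots> = fps_const (c/2) * fps_X * ((E ^ p - 1) * (E + 1))"
        unfolding geo by (simp add: algebra_simps)
      also have "\<dots> = of_nat p * bgf y (c / real p) * (E - 1) * (E ^ p - 1)"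
        unfolding 2 by (simp add: mult_ac)
      finally show ?thesis
        by (simp add: Ep mult_ac flip: E_def)
    qed
  qed
qed

text \<open>The addition theorem of the hyperbolic cotangent, with characteristics. For generic \<open>u\<close> and \<open>v\<close>
  it comes down to \<open>e\<^bsup>X+Y\<^esup> - 1 = (e\<^bsup>X\<^esup> - 1) + e\<^bsup>X\<^esup> (e\<^bsup>Y\<^esup> - 1)\<close>.\<close>

lemma bgf_product:
  assumes "X \<noteq> 0" "Y \<noteq> 0" "X + Y \<noteq> 0"
  shows "bgf u X * bgf v Y * fps_const (X + Y)
       = bgf v (X + Y) * bgf (u - v) X * fps_const Y + bgf u (X + Y) * bgf (v - u) Y * fps_const X
         - (if u \<in> \<int> \<and> v \<in> \<int> then fps_const (X * Y * (X + Y) / 4) * fps_X ^ 2 else 0)"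
    (is "?L = ?R")
proof -
  define a where "a = fps_exp X"
  define b where "b = fps_exp Y"
  have ab: "fps_exp (X + Y) = a * b" by (simp add: a_def b_def fps_exp_add_mult)
  define K where "K = fps_const (X * Y * (X + Y)) * fps_X ^ 2"
  \<comment> \<open>Numerator of \<open>bgf x c\<close> over \<open>fps_exp c - 1\<close>, without
    the factor \<open>c t\<close>.\<close>
  define n where "n = (\<lambda>x c::real. if x \<in> \<int> then fps_const (1/2) * (fps_exp c + 1) else fps_exp (c * frac x))"
  have n: "bgf x c * (fps_exp c - 1) = fps_const c * fps_X * n x c" for x c
  proof -
    have "fps_const (c / 2) = fps_const c * fps_const (1/2)" by simp
    then show ?thesis by (simp add: bgf_int bgf_nonint n_def mult_ac del: fps_const_mult)
  qed
  \<comment> \<open>This is the 1 in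
    \<open>coth a coth b + 1 = coth (a + b) (coth a + coth b)\<close>; it becomes 1/4 because every
    \<open>coth\<close> comes with a factor 1/2.\<close>
  define D where "D = (if u \<in> \<int> \<and> v \<in> \<int> then fps_const (1 / 4) else (0 :: real fps))"
  have D: "(if u \<in> \<int> \<and> v \<in> \<int> then fps_const (X * Y * (X + Y) / 4) * fps_X ^ 2 else 0) = K * D"
    by (simp add: K_def D_def algebra_simps)
  have K3: "K = fps_const X * fps_X * (fps_const Y * fps_X) * fps_const (X + Y)"
    by (simp add: K_def power2_eq_square algebra_simps flip: fps_const_mult)
  have main: "n u X * n v Y * (a * b - 1)
      = n v (X + Y) * n (u - v) X * (b - 1) + n u (X + Y) * n (v - u) Y * (a - 1)
        - D * (a - 1) * (b - 1) * (a * b - 1)"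
  proof -
    define h where "h = fps_const (1 / 2 :: real)"
    have hh: "h * h = fps_const (1/4)" and h2: "2 * h = 1"
      by (simp_all add: h_def numeral_fps_const)
    define fX where "fX = (\<lambda>x. fps_exp (X * frac x))"
    define fY where "fY = (\<lambda>x. fps_exp (Y * frac x))"
    have nS: "n x (X + Y) = fX x * fY x" if "x \<notin> \<int>" for x
      using that by (simp add: n_def fX_def fY_def distrib_right fps_exp_add_mult)
    have nX: "n x X = fX x" and nY: "n x Y = fY x" if "x \<notin> \<int>" for x
      using that by (simp_all add: n_def fX_def fY_def)
    have n1: "n x X = h * (a + 1)" "n x Y = h * (b + 1)" "n x (X + Y) = h * (a * b + 1)" if "x \<in> \<int>" for x
      using that by (simp_all add: n_def h_def a_def b_def fps_exp_add_mult)
    \<comment> \<open>Fractional parts add without a carry here. In \<open>diff'\<close> there is a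
      carry, which contributes one full period, that is a factor \<open>a\<close> or
      \<open>b\<close>.\<close>
    have diff: "fX (x - y) * fX y = fX x \<and> fY (x - y) * fY y = fY x" if "frac x \<ge> frac y" for x y
    proof -
      have "frac (x - y) = frac x - frac y"
      proof (subst frac_unique_iff, intro conjI)
        have "x - y - (frac x - frac y) = of_int (\<lfloor>x\<rfloor> - \<lfloor>y\<rfloor>)" by (simp add: frac_def)
        then show "x - y - (frac x - frac y) \<in> \<int>" by (metis Ints_of_int)
        show "0 \<le> frac x - frac y" using that by simp
        show "frac x - frac y < 1" using frac_lt_1[of x] frac_ge_0[of y] by linarith
      qed
      then show ?thesis by (simp add: fX_def fY_def flip: fps_exp_add_mult distrib_left)
    qed
    have diff': "fX (x - y) * fX y = fX x * a \<and> fY (x - y) * fY y = fY x * b" if "frac x < frac y" for x y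
    proof -
      have "frac (x - y) = frac x - frac y + 1"
      proof (subst frac_unique_iff, intro conjI)
        have "x - y - (frac x - frac y + 1) = of_int (\<lfloor>x\<rfloor> - \<lfloor>y\<rfloor> - 1)" by (simp add: frac_def)
        then show "x - y - (frac x - frac y + 1) \<in> \<int>" by (metis Ints_of_int)
        show "0 \<le> frac x - frac y + 1" using frac_lt_1[of y] frac_ge_0[of x] by linarith
        show "frac x - frac y + 1 < 1" using that by simp
      qed
      then have "c * frac (x - y) + c * frac y = c * frac x + c" for c
        by (simp only:) (simp add: algebra_simps)
      then show ?thesis
        by (simp add: fX_def fY_def a_def b_def flip: fps_exp_add_mult)
    qed
    have f0: "frac x = 0" "fX x = 1" "fY x = 1" if "x \<in> \<int>" for x
      using that by (simp_all add: fX_def fY_def frac_eq_0_iff[THEN iffD2])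
    have fpos: "frac x > 0" if "x \<notin> \<int>" for x :: real
      using that by (simp add: frac_gt_0_iff)
    \<comment> \<open>Halved numerators occur exactly where \<open>u\<close>, \<open>v\<close> or
      \<open>u - v\<close> is integral. In the three cases with just one of them integral the halves
      recombine through \<open>2 * h = 1\<close>.\<close>
    consider "u \<in> \<int>" "v \<in> \<int>" | "u \<in> \<int>" "v \<notin> \<int>" | "u \<notin> \<int>" "v \<in> \<int>"
      | "u \<notin> \<int>" "v \<notin> \<int>" "u - v \<in> \<int>" | "u \<notin> \<int>" "v \<notin> \<int>" "u - v \<notin> \<int>" by blast
    then show ?thesis
    proof cases
      case 1
      then have "u - v \<in> \<int>" "v - u \<in> \<int>" by auto
      then show ?thesis using 1 hh[symmetric] unfolding D_def by (simp add: n1 algebra_simps)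
    next
      case 2
      then have "u - v \<notin> \<int>" "v - u \<notin> \<int>"
        by (metis Ints_diff diff_diff_eq2 add_diff_cancel_left' diff_add_cancel Ints_add)+
      moreover have "fX (u - v) * fX v = a" "fY (v - u) = fY v"
        using diff'[of u v] diff[of u v] diff[of v u] f0[of u] fpos[of v] 2 by auto
      moreover have "h * (a + 1) * fY v * (a * b - 1) - h * (a * b + 1) * fY v * (a - 1)
          = 2 * h * (a * fY v * (b - 1))"
        by (simp add: algebra_simps)
      moreover have "fX v * fY v * fX (u - v) = a * fY v"
        using \<open>fX (u - v) * fX v = a\<close> by (metis mult.assoc mult.commute)
      ultimately show ?thesis using 2 h2
        by (auto simp: n1 nS nX nY D_def diff_eq_eq mult.commute[of "fX v" "fX (u - v)"])
    next
      case 3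
      then have "u - v \<notin> \<int>" "v - u \<notin> \<int>"
        by (metis Ints_diff diff_diff_eq2 add_diff_cancel_left' diff_add_cancel Ints_add)+
      moreover have "fY (v - u) * fY u = b" "fX (u - v) = fX u"
        using diff'[of v u] diff[of u v] diff[of v u] f0[of v] fpos[of u] 3 by auto
      moreover have "fX u * (h * (b + 1)) * (a * b - 1) - h * (a * b + 1) * fX u * (b - 1)
          = 2 * h * (b * fX u * (a - 1))"
        by (simp add: algebra_simps)
      moreover have "fX u * fY u * fY (v - u) = b * fX u"
        using \<open>fY (v - u) * fY u = b\<close> by (metis mult.assoc mult.commute)
      ultimately show ?thesis using 3 h2
        by (auto simp: n1 nS nX nY D_def diff_eq_eq add.commute mult.commute[of "fY u" "fY (v - u)"])
    next
      case 4
      then have "v - u \<in> \<int>" using Ints_minus[of "u - v"] by simp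
      moreover have "frac u = frac v"
        using 4 by (metis frac_add_int_right add.commute diff_add_cancel)
      then have "fX u = fX v" "fY u = fY v" by (simp_all add: fX_def fY_def)
      moreover have "fX v * fY v * (h * (a + 1)) * (b - 1) + fX v * fY v * (h * (b + 1)) * (a - 1)
          = 2 * h * (fX v * fY v * (a * b - 1))"
        by (simp add: algebra_simps)
      ultimately show ?thesis using 4 h2 by (simp add: n1 nS nX nY D_def)
    next
      case 5
      then have 6: "v - u \<notin> \<int>" using Ints_minus[of "v - u"] by auto
      have "frac u \<noteq> frac v"
      proof
        assume "frac u = frac v"
        then have "u - v = of_int (\<lfloor>u\<rfloor> - \<lfloor>v\<rfloor>)" by (simp add: frac_def)
        then show False using 5 by (metis Ints_of_int)
      qed
      then have "frac u > frac v \<or> frac u < frac v" by auto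
      then show ?thesis
      proof
        assume "frac u > frac v"
        then have "fX (u - v) * fX v = fX u" "fY (v - u) * fY u = fY v * b"
          using diff[of v u] diff'[of v u] by (auto simp: diff)
        moreover have "fX v * fY v * fX (u - v) = fX u * fY v" "fX u * fY u * fY (v - u) = fX u * fY v * b"
          using calculation by (metis mult.assoc mult.commute)+
        then have "fX v * fY v * fX (u - v) * (b - 1) + fX u * fY u * fY (v - u) * (a - 1)
            = fX u * fY v * (a * b - 1)"
          by (simp only:) (simp add: algebra_simps)
        then show ?thesis
          using 5 6 by (simp only: nS nX nY D_def simp_thms if_False mult_zero_left diff_zero)
      next
        assume "frac u < frac v"
        then have "fX (u - v) * fX v = fX u * a" "fY (v - u) * fY u = fY v"
          using diff[of v u] diff'[of u v] by (auto simp: diff)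
        moreover have "fX v * fY v * fX (u - v) = fX u * fY v * a" "fX u * fY u * fY (v - u) = fX u * fY v"
          using calculation by (metis mult.assoc mult.commute)+
        then have "fX v * fY v * fX (u - v) * (b - 1) + fX u * fY u * fY (v - u) * (a - 1)
            = fX u * fY v * (a * b - 1)"
          by (simp only:) (simp add: algebra_simps)
        then show ?thesis
          using 5 6 by (simp only: nS nX nY D_def simp_thms if_False mult_zero_left diff_zero)
      qed
    qed
  qed
  have "?L * ((a - 1) * (b - 1) * (a * b - 1)) = K * (n u X * n v Y * (a * b - 1))"
  proof -
    have "?L * ((a - 1) * (b - 1) * (a * b - 1))
       = (bgf u X * (a - 1)) * (bgf v Y * (b - 1)) * fps_const (X + Y) * (a * b - 1)"
      by (simp add: mult_ac)
    then show ?thesis unfolding a_def b_def n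
      by (simp add: K3 mult_ac del: fps_const_add fps_const_mult)
  qed
  moreover have "?R * ((a - 1) * (b - 1) * (a * b - 1))
     = K * (n v (X + Y) * n (u - v) X * (b - 1) + n u (X + Y) * n (v - u) Y * (a - 1)
        - D * (a - 1) * (b - 1) * (a * b - 1))"
  proof -
    have "?R * ((a - 1) * (b - 1) * (a * b - 1))
       = (bgf v (X + Y) * (a * b - 1)) * (bgf (u - v) X * (a - 1)) * fps_const Y * (b - 1)
       + (bgf u (X + Y) * (a * b - 1)) * (bgf (v - u) Y * (b - 1)) * fps_const X * (a - 1)
       - K * D * (a - 1) * (b - 1) * (a * b - 1)"
      unfolding D by (simp add: algebra_simps)
    also have "\<dots> = K * (n v (X + Y) * n (u - v) X * (b - 1)) + K * (n u (X + Y) * n (v - u) Y * (a - 1))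
       - K * D * (a - 1) * (b - 1) * (a * b - 1)"
      unfolding ab[symmetric] unfolding a_def b_def n
      by (simp add: K3 mult_ac del: fps_const_add fps_const_mult)
    finally show ?thesis by (simp add: algebra_simps)
  qed
  ultimately have "?L * ((a - 1) * (b - 1) * (a * b - 1)) = ?R * ((a - 1) * (b - 1) * (a * b - 1))"
    using main by simp
  moreover have "a - 1 \<noteq> 0" "b - 1 \<noteq> 0" "a * b - 1 \<noteq> 0"
    unfolding ab[symmetric] unfolding a_def b_def by (rule fps_exp_minus_1_nonzero, fact)+
  then have "(a - 1) * (b - 1) * (a * b - 1) \<noteq> 0" by (intro no_zero_divisors)
  ultimately show ?thesis using mult_right_cancel by blast
qed

section \<open>Reciprocity\<close>

text \<open>The addition theorem is summed over \<open>u = h/q + k/p\<close> and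
  \<open>v = h/q\<close>. In the first product the sum over \<open>k\<close> collapses by the
  multiplication theorem, in the last one the sum over \<open>h\<close>, and in the middle one,
  where \<open>v = h/q\<close> and \<open>u - v = k/p\<close> separate, both do. Only
  \<open>h = k = 0\<close> makes \<open>u\<close> and \<open>v\<close> integral, hence a single
  correction term.\<close>

lemma bgf_reciprocity:
  assumes X: "X \<noteq> 0" "Y \<noteq> 0" "X + Y \<noteq> 0" and p: "p > 0" and q: "q > 0"
  shows "of_nat p * (\<Sum>h<q. bgf (real h / real q) Y * bgf (real p * real h / real q) (X / real p))
           * fps_const (X + Y)
       = of_nat (p * q) * (bgf 0 ((X + Y) / real q) * bgf 0 (X / real p)) * fps_const Y
         + of_nat q * (\<Sum>k<p. bgf (- (real k / real p)) Y * bgf (real q * real k / real p) ((X + Y) / real q))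
           * fps_const X
         - fps_const (X * Y * (X + Y) / 4) * fps_X ^ 2"
proof -
  let ?I = "\<lambda>u v. if u \<in> \<int> \<and> v \<in> \<int> then fps_const (X * Y * (X + Y) / 4) * fps_X ^ 2 else (0 :: real fps)"
  define u where "u = (\<lambda>h k. real h / real q + real k / real p)"
  define v where "v = (\<lambda>h. real h / real q)"
  have int0: "real h / real n \<in> \<int> \<longleftrightarrow> h = 0" if "h < n" for h n :: nat
  proof
    assume "real h / real n \<in> \<int>"
    then have "frac (real h / real n) = 0" by simp
    moreover have "frac (real h / real n) = real h / real n"
      using that by (simp add: frac_eq)
    ultimately show "h = 0" using that by auto
  qed auto
  have eq: "(\<Sum>h<q. \<Sum>k<p. bgf (u h k) X * bgf (v h) Y * fps_const (X + Y))
    = (\<Sum>h<q. \<Sum>k<p. bgf (v h) (X + Y) * bgf (u h k - v h) X * fps_const Y)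
      + (\<Sum>h<q. \<Sum>k<p. bgf (u h k) (X + Y) * bgf (v h - u h k) Y * fps_const X)
      - (\<Sum>h<q. \<Sum>k<p. ?I (u h k) (v h))"
    by (subst bgf_product[OF X]) (simp add: sum.distrib sum_subtractf)
  have 1: "(\<Sum>h<q. \<Sum>k<p. bgf (u h k) X * bgf (v h) Y * fps_const (X + Y))
     = of_nat p * (\<Sum>h<q. bgf (real h / real q) Y * bgf (real p * real h / real q) (X / real p))
           * fps_const (X + Y)"
  proof -
    have "(\<Sum>k<p. bgf (u h k) X * bgf (v h) Y * fps_const (X + Y))
       = of_nat p * (bgf (real h / real q) Y * bgf (real p * real h / real q) (X / real p)) * fps_const (X + Y)" for h
      using bgf_distribution[OF p X(1), of "real h / real q"]
      by (simp add: u_def v_def flip: sum_distrib_right)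
    then show ?thesis by (simp add: sum_distrib_left sum_distrib_right)
  qed
  have 2: "(\<Sum>h<q. \<Sum>k<p. bgf (v h) (X + Y) * bgf (u h k - v h) X * fps_const Y)
     = of_nat (p * q) * (bgf 0 ((X + Y) / real q) * bgf 0 (X / real p)) * fps_const Y"
  proof -
    have "(\<Sum>h<q. \<Sum>k<p. bgf (v h) (X + Y) * bgf (u h k - v h) X * fps_const Y)
        = (\<Sum>h<q. bgf (real h / real q) (X + Y)) * (\<Sum>k<p. bgf (real k / real p) X) * fps_const Y"
      unfolding sum_product by (simp add: u_def v_def sum_distrib_right)
    then show ?thesis
      using bgf_distribution[OF p X(1), of 0] bgf_distribution[OF q X(3), of 0]
      by (simp add: mult_ac)
  qed
  have 3: "(\<Sum>h<q. \<Sum>k<p. bgf (u h k) (X + Y) * bgf (v h - u h k) Y * fps_const X)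
     = of_nat q * (\<Sum>k<p. bgf (- (real k / real p)) Y * bgf (real q * real k / real p) ((X + Y) / real q))
           * fps_const X"
  proof -
    have "(\<Sum>h<q. bgf (u h k) (X + Y) * bgf (v h - u h k) Y * fps_const X)
       = of_nat q * (bgf (- (real k / real p)) Y * bgf (real q * real k / real p) ((X + Y) / real q)) * fps_const X" for k
      using bgf_distribution[OF q X(3), of "real k / real p"]
      by (simp add: u_def v_def add.commute flip: sum_distrib_right)
    then show ?thesis by (subst sum.swap) (simp add: sum_distrib_left sum_distrib_right)
  qed
  have 4: "(\<Sum>h<q. \<Sum>k<p. ?I (u h k) (v h)) = fps_const (X * Y * (X + Y) / 4) * fps_X ^ 2"
  proof -
    have *: "u h k \<in> \<int> \<and> v h \<in> \<int> \<longleftrightarrow> h = 0 \<and> k = 0" if "h < q" "k < p" for h k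
      using int0[OF that(1)] int0[OF that(2)] by (auto simp: u_def v_def)
    have "(\<Sum>h<q. \<Sum>k<p. ?I (u h k) (v h))
        = (\<Sum>h<q. \<Sum>k<p. if h = 0 \<and> k = 0 then fps_const (X * Y * (X + Y) / 4) * fps_X ^ 2 else 0)"
      using * by (intro sum.cong refl) auto
    also have "\<dots> = (\<Sum>h<q. if h = 0 then fps_const (X * Y * (X + Y) / 4) * fps_X ^ 2 else 0)"
    proof (intro sum.cong refl)
      fix h show "(\<Sum>k<p. if h = 0 \<and> k = 0 then fps_const (X * Y * (X + Y) / 4) * fps_X ^ 2 else 0)
        = (if h = 0 then fps_const (X * Y * (X + Y) / 4) * fps_X ^ 2 else (0::real fps))"
        using p by (cases "h = 0") (simp_all add: sum.delta)
    qed
    also have "\<dots> = fps_const (X * Y * (X + Y) / 4) * fps_X ^ 2"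
      using q by (simp add: sum.delta)
    finally show ?thesis .
  qed
  show ?thesis using eq unfolding 1 2 3 4 .
qed

lemma bgf_mult_nth:
  "fact N * (bgf x c * bgf y d) $ N
   = (\<Sum>i\<le>N. real (N choose i) * c ^ i * d ^ (N - i) * (periodic_bernoulli i x * periodic_bernoulli (N - i) y))"
  unfolding fps_mult_nth sum_distrib_left atLeast0AtMost
  by (intro sum.cong) (auto simp: bgf_nth binomial_fact field_simps)

text \<open>\<open>N!\<close> times the coefficient of degree \<open>N\<close> in the series
  identity. The sign \<open>(-1) ^ i\<close> stems from the arguments \<open>-k/p\<close>; the
  correction lives in degree 2 alone.\<close>

lemma dedekind_reciprocity:
  assumes X: "X \<noteq> 0" "Y \<noteq> 0" "X + Y \<noteq> 0" and p: "p > 0" and q: "q > 0"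
  shows "real p * (X + Y) * (\<Sum>i\<le>N. real (N choose i) * Y ^ i * (X / p) ^ (N - i) * dedekind_sum i (N - i) p q)
       = real p * real q * Y * (\<Sum>i\<le>N. real (N choose i) * ((X + Y) / q) ^ i * (X / p) ^ (N - i) *
            (periodic_bernoulli i 0 * periodic_bernoulli (N - i) 0))
       + real q * X * (\<Sum>i\<le>N. real (N choose i) * Y ^ i * ((X + Y) / q) ^ (N - i) *
            ((-1) ^ i * dedekind_sum i (N - i) q p))
       - (if N = 2 then X * Y * (X + Y) / 2 else 0)"
proof -
  have nth: "(of_nat n * f * fps_const c) $ N = real n * f $ N * c" for n f c
    by (simp flip: fps_of_nat)
  have sum1: "fact N * (\<Sum>h<n. bgf (s * (real h / real n)) c * bgf (real m * real h / real n) d) $ N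
      = (\<Sum>i\<le>N. real (N choose i) * c ^ i * d ^ (N - i) *
          (\<Sum>h<n. periodic_bernoulli i (s * (real h / real n)) * periodic_bernoulli (N - i) (real m * real h / real n)))"
    for n m s c d
    unfolding fps_sum_nth sum_distrib_left bgf_mult_nth by (rule sum.swap)
  have A: "fact N * (\<Sum>h<q. bgf (real h / real q) Y * bgf (real p * real h / real q) (X / p)) $ N
      = (\<Sum>i\<le>N. real (N choose i) * Y ^ i * (X / p) ^ (N - i) * dedekind_sum i (N - i) p q)"
    using sum1[where s = 1 and n = q and m = p] by (simp add: dedekind_sum_def)
  have B: "fact N * (\<Sum>k<p. bgf (- (real k / real p)) Y * bgf (real q * real k / real p) ((X + Y) / q)) $ N
      = (\<Sum>i\<le>N. real (N choose i) * Y ^ i * ((X + Y) / q) ^ (N - i) * ((-1) ^ i * dedekind_sum i (N - i) q p))"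
    using sum1[where s = "-1" and n = p and m = q]
    by (simp add: dedekind_sum_def periodic_bernoulli_reflect sum_distrib_left mult_ac)
  have C: "(fps_const (X * Y * (X + Y) / 4) * fps_X ^ 2) $ N * fact N = (if N = 2 then X * Y * (X + Y) / 2 else 0)"
    by (simp add: fps_X_power_nth)
  from arg_cong[OF bgf_reciprocity[OF assms], of "\<lambda>f. fact N * f $ N"]
  show ?thesis
    unfolding fps_add_nth fps_sub_nth nth A[symmetric] B[symmetric] bgf_mult_nth[symmetric] C[symmetric]
    by (simp add: algebra_simps)
qed

section \<open>Values at the integers and degenerate Dedekind sums\<close>

lemma periodic_bernoulli_0: "periodic_bernoulli 0 x = 1"
proof -
  have "(bgf x 1 * (fps_exp 1 - 1)) $ 1 = 1"
    by (cases "x \<in> \<int>") (simp_all add: bgf_int bgf_nonint mult.assoc)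
  then show ?thesis by (simp add: fps_mult_nth bgf_nth)
qed

lemma periodic_bernoulli_odd: "odd k \<Longrightarrow> periodic_bernoulli k 0 = 0"
  using periodic_bernoulli_reflect[of k 0] by simp

lemma periodic_bernoulli_even: "even k \<Longrightarrow> periodic_bernoulli k 0 = of_rat (bernoulli k)"
  by (auto simp: periodic_bernoulli_def)

lemma periodic_bernoulli_mod:
  assumes "q > 0"
  shows "periodic_bernoulli k (of_int (m mod int q) / real q) = periodic_bernoulli k (of_int m / real q)"
proof -
  have "m = m mod int q + int q * (m div int q)" by simp
  then have "real_of_int m = of_int (m mod int q) + real q * of_int (m div int q)"
    by (metis of_int_add of_int_mult of_int_of_nat_eq)
  then have "of_int m / real q = of_int (m mod int q) / real q + of_int (m div int q)"
    using assms by (simp add: field_simps)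
  then show ?thesis by (simp only: periodic_bernoulli_shift)
qed

lemma sum_periodic_bernoulli:
  assumes "q > 0"
  shows "(\<Sum>k<q. periodic_bernoulli N (real k / real q)) * real q ^ N = real q * periodic_bernoulli N 0"
proof -
  have "(\<Sum>k<q. bgf (0 + real k / real q) 1) $ N = (of_nat q * bgf (real q * 0) (1 / real q)) $ N"
    using assms by (subst bgf_distribution) auto
  then have "(\<Sum>k<q. periodic_bernoulli N (real k / real q)) / fact N
      = real q * ((1 / q) ^ N * periodic_bernoulli N 0 / fact N)"
    by (simp add: fps_sum_nth bgf_nth sum_divide_distrib flip: fps_of_nat)
  then show ?thesis using assms by (simp add: field_simps)
qed

lemma dedekind_sum_0_right:
  assumes "q > 0"
  shows "dedekind_sum N 0 p q * real q ^ N = real q * periodic_bernoulli N 0"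
  using sum_periodic_bernoulli[OF assms] by (simp add: dedekind_sum_def periodic_bernoulli_0)

lemma dedekind_sum_0_left:
  assumes "q > 0" "coprime p q"
  shows "dedekind_sum 0 N p q * real q ^ N = real q * periodic_bernoulli N 0"
proof -
  have "dedekind_sum 0 N p q = (\<Sum>k<q. (\<lambda>m. periodic_bernoulli N (of_int m / real q)) (int p * int k + 0))"
    by (simp add: dedekind_sum_def periodic_bernoulli_0)
  also have "\<dots> = (\<Sum>k<q. periodic_bernoulli N (of_int (int k) / real q))"
    by (rule sum_affine_residues) (use assms in \<open>auto simp: periodic_bernoulli_mod\<close>)
  finally show ?thesis using sum_periodic_bernoulli[OF assms(1)] by simp
qed

lemma dedekind_sum_cong:
  assumes "q > 0" "[int p = int p'] (mod int q)"
  shows "dedekind_sum i j p q = dedekind_sum i j p' q"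
proof -
  have "periodic_bernoulli j (real p * real k / real q) = periodic_bernoulli j (real p' * real k / real q)" for k
  proof -
    have "(int p * int k) mod int q = (int p' * int k) mod int q"
      using assms(2) by (metis cong_def cong_scalar_right)
    then show ?thesis
      using periodic_bernoulli_mod[OF assms(1), of j "int p * int k"]
        periodic_bernoulli_mod[OF assms(1), of j "int p' * int k"] by simp
  qed
  then show ?thesis by (simp add: dedekind_sum_def)
qed

lemma dedekind_sum_diff:
  assumes "q > 0" "p \<le> q"
  shows "dedekind_sum i j (q - p) q = (-1) ^ j * dedekind_sum i j p q"
proof -
  have "periodic_bernoulli j (real (q - p) * real k / real q) = (-1) ^ j * periodic_bernoulli j (real p * real k / real q)" for k
  proof -
    have "real (q - p) * real k / real q = - (real p * real k / real q) + of_int (int k)"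
      using assms by (simp add: of_nat_diff field_simps)
    then show ?thesis by (simp only: periodic_bernoulli_shift periodic_bernoulli_reflect)
  qed
  then show ?thesis by (simp add: dedekind_sum_def sum_distrib_left mult_ac)
qed

section \<open>Integrality and the congruence modulo \<open>q\<close>\<close>

text \<open>The number \<open>U_i(p,q)\<close> of the overview, with \<open>N\<close> kept fixed; it
  is real-valued because its integrality is a theorem.\<close>

definition scaled_dedekind :: "nat \<Rightarrow> nat \<Rightarrow> nat \<Rightarrow> nat \<Rightarrow> real" where
  "scaled_dedekind N i p q = of_int (bernoulli_denom N * r_lcm N) * real (N choose i) * real q ^ (N - 1)
     * dedekind_sum i (N - i) p q"

text \<open>The product \<open>r_N \<alpha>_N\<close>. It is the value of
  \<open>scaled_dedekind\<close> at both ends \<open>i = 0\<close> and \<open>i = N\<close>, and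
  hence the constant in the congruence.\<close>

definition scaled_bernoulli :: "nat \<Rightarrow> int" where
  "scaled_bernoulli N = r_lcm N * fst (quotient_of (bernoulli N))"

lemma rat_denom_pos: "rat_denom x > 0"
  by (simp add: rat_denom_def quotient_of_denom_pos')

lemma rat_denom_mult: "of_int (rat_denom x) * x = of_int (fst (quotient_of x))"
proof -
  have "x = of_int (fst (quotient_of x)) / of_int (rat_denom x)"
    by (simp add: rat_denom_def quotient_of_div)
  moreover have "rat_denom x \<noteq> 0" using rat_denom_pos[of x] by simp
  ultimately show ?thesis by (metis nonzero_mult_div_cancel_left of_int_eq_0_iff times_divide_eq_right)
qed

lemma scaled_bernoulli_eq:
  assumes "even N"
  shows "of_int (scaled_bernoulli N) = of_int (bernoulli_denom N * r_lcm N) * periodic_bernoulli N 0"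
proof -
  have "real_of_rat (of_int (rat_denom (bernoulli N)) * bernoulli N) = of_int (fst (quotient_of (bernoulli N)))"
    unfolding rat_denom_mult by simp
  then have "of_int (bernoulli_denom N) * periodic_bernoulli N 0 = of_int (fst (quotient_of (bernoulli N)))"
    using assms by (simp add: periodic_bernoulli_even bernoulli_denom_def of_rat_mult)
  then show ?thesis by (simp add: scaled_bernoulli_def mult_ac)
qed

lemma dedekind_sum_1: "dedekind_sum i j p 1 = periodic_bernoulli i 0 * periodic_bernoulli j 0"
  by (simp add: dedekind_sum_def)

lemma scaled_dedekind_0:
  assumes "q > 0" "coprime p q" "even N" "N > 0"
  shows "scaled_dedekind N 0 p q = of_int (scaled_bernoulli N)"
proof -
  have "real q ^ N = real q * real q ^ (N - 1)"
    using assms by (simp add: power_eq_if)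
  then have "dedekind_sum 0 N p q * real q ^ (N - 1) = periodic_bernoulli N 0"
    using dedekind_sum_0_left[OF assms(1,2), of N] assms(1) by simp
  then show ?thesis
    using assms by (simp add: scaled_dedekind_def scaled_bernoulli_eq mult_ac)
qed

lemma scaled_dedekind_N:
  assumes "q > 0" "even N" "N > 0"
  shows "scaled_dedekind N N p q = of_int (scaled_bernoulli N)"
proof -
  have "real q ^ N = real q * real q ^ (N - 1)"
    using assms by (simp add: power_eq_if)
  then have "dedekind_sum N 0 p q * real q ^ (N - 1) = periodic_bernoulli N 0"
    using dedekind_sum_0_right[OF assms(1), of N p] assms(1) by simp
  then show ?thesis
    using assms by (simp add: scaled_dedekind_def scaled_bernoulli_eq mult_ac)
qed

text \<open>For even \<open>i\<close> this is \<open>\<beta>_N r_N C(N,i) B_i B_(N-i)\<close>, whose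
  denominator \<open>r_N\<close> was made to clear; the index set of \<open>r_lcm\<close> contains
  it under the odd number \<open>i - 1\<close>. For odd \<open>i\<close> a Bernoulli factor
  vanishes.\<close>

lemma scaled_dedekind_1_int:
  assumes "even N" "i \<ge> 1" "i < N"
  shows "scaled_dedekind N i p 1 \<in> \<int>"
proof (cases "even i")
  case False
  then show ?thesis unfolding scaled_dedekind_def dedekind_sum_1 by (simp add: periodic_bernoulli_odd)
next
  case True
  define y where "y = of_int (bernoulli_denom N) * of_nat (N choose (i - 1 + 1)) *
                     bernoulli (i - 1 + 1) * bernoulli (N - (i - 1) - 1)"
  have "odd (i - 1) \<and> i - 1 \<le> N - 2" using assms True by auto
  then have "rat_denom y dvd r_lcm N"
    unfolding r_lcm_def y_def by (intro dvd_Lcm) blast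
  then obtain k where "r_lcm N = rat_denom y * k" by (elim dvdE)
  then have "of_int (r_lcm N) * y = of_int (k * fst (quotient_of y))"
    using rat_denom_mult[of y] by (simp add: mult_ac)
  then have "real_of_rat (of_int (r_lcm N) * y) = of_int (k * fst (quotient_of y))"
    by (metis of_rat_of_int_eq)
  moreover have "real_of_rat (of_int (r_lcm N) * y) = scaled_dedekind N i p 1"
    unfolding scaled_dedekind_def dedekind_sum_1
    using assms True
    by (simp add: y_def periodic_bernoulli_even of_rat_mult)
  ultimately show ?thesis by (metis Ints_of_int)
qed

text \<open>The case \<open>X = x\<close>, \<open>Y = 1\<close> of the reciprocity law, multiplied
  by \<open>\<beta>_N r_N (p q)^(N-1)\<close>. The Bernoulli products reappear as
  \<open>scaled_dedekind N i 1 1\<close>, and \<open>x\<close> is left free so that both sides can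
  be compared as polynomials.\<close>

lemma scaled_reciprocity:
  fixes x :: real
  assumes "x > 0" "p > 0" "q > 0" "N > 0"
  shows "(x + 1) * (\<Sum>i\<le>N. real p ^ i * scaled_dedekind N i p q * x ^ (N - i))
    = (\<Sum>i\<le>N. scaled_dedekind N i 1 1 * real q ^ (N - i) * real p ^ i * ((x + 1) ^ i * x ^ (N - i)))
      + x * (\<Sum>i\<le>N. (-1) ^ i * scaled_dedekind N i q p * real q ^ i * (x + 1) ^ (N - i))
      - (if N = 2 then of_int (bernoulli_denom N * r_lcm N) / 2 * real p * real q * (x * (x + 1)) else 0)"
proof -
  define K where "K = real_of_int (bernoulli_denom N * r_lcm N)"
  define M where "M = K * real p ^ (N - 1) * real q ^ (N - 1)"
  have pow: "real n * real n ^ (N - 1) * (y / n) ^ (N - i) = real n ^ i * y ^ (N - i)"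
    if "n > 0" "i \<le> N" for n i y
  proof -
    have "real n * real n ^ (N - 1) = real n ^ N" using assms by (simp add: power_eq_if)
    also have "\<dots> = real n ^ i * real n ^ (N - i)" using that by (simp flip: power_add)
    finally show ?thesis using that by (simp add: power_divide)
  qed
  have pow': "real n * real n ^ (N - 1) * (y / n) ^ i = real n ^ (N - i) * y ^ i"
    if "n > 0" "i \<le> N" for n i y
    using pow[of n "N - i" y] that by simp
  note rec = arg_cong[OF dedekind_reciprocity[of x 1 p q N], of "\<lambda>t. M * t"]
  have 1: "M * (real p * (x + 1) * (\<Sum>i\<le>N. real (N choose i) * 1 ^ i * (x / p) ^ (N - i) * dedekind_sum i (N - i) p q))
     = (x + 1) * (\<Sum>i\<le>N. real p ^ i * scaled_dedekind N i p q * x ^ (N - i))"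
    (is "M * (real p * (x + 1) * (\<Sum>i\<le>N. ?f i)) = _ * (\<Sum>i\<le>N. ?g i)")
  proof -
    have "M * real p * ?f i = ?g i" if "i \<le> N" for i
    proof -
      have "M * real p * ?f i
         = K * real q ^ (N - 1) * real (N choose i) * dedekind_sum i (N - i) p q
           * (real p * real p ^ (N - 1) * (x / p) ^ (N - i))"
        by (simp add: M_def mult_ac)
      then show ?thesis
        unfolding pow[OF assms(2) that] by (simp add: scaled_dedekind_def K_def mult_ac)
    qed
    then have "M * real p * (\<Sum>i\<le>N. ?f i) = (\<Sum>i\<le>N. ?g i)"
      unfolding sum_distrib_left by (intro sum.cong) auto
    then show ?thesis by (simp add: mult_ac)
  qed
  have 2: "M * (real p * real q * 1 * (\<Sum>i\<le>N. real (N choose i) * ((x + 1) / q) ^ i * (x / p) ^ (N - i) *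
            (periodic_bernoulli i 0 * periodic_bernoulli (N - i) 0)))
     = (\<Sum>i\<le>N. scaled_dedekind N i 1 1 * real q ^ (N - i) * real p ^ i * ((x + 1) ^ i * x ^ (N - i)))"
    (is "M * (_ * _ * 1 * (\<Sum>i\<le>N. ?f i)) = (\<Sum>i\<le>N. ?g i)")
  proof -
    have "M * (real p * real q * 1) * ?f i = ?g i" if "i \<le> N" for i
    proof -
      have "M * (real p * real q * 1) * ?f i
         = K * real (N choose i) * (periodic_bernoulli i 0 * periodic_bernoulli (N - i) 0)
           * (real p * real p ^ (N - 1) * (x / p) ^ (N - i))
           * (real q * real q ^ (N - 1) * ((x + 1) / q) ^ i)"
        by (simp add: M_def mult_ac)
      then show ?thesis
        unfolding pow[OF assms(2) that] pow'[OF assms(3) that]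
        by (simp add: scaled_dedekind_def dedekind_sum_1[unfolded One_nat_def] K_def mult_ac)
    qed
    then show ?thesis
      unfolding sum_distrib_left mult.assoc[symmetric] by (intro sum.cong) (auto simp: mult_ac)
  qed
  have 3: "M * (real q * x * (\<Sum>i\<le>N. real (N choose i) * 1 ^ i * ((x + 1) / q) ^ (N - i) *
            ((-1) ^ i * dedekind_sum i (N - i) q p)))
     = x * (\<Sum>i\<le>N. (-1) ^ i * scaled_dedekind N i q p * real q ^ i * (x + 1) ^ (N - i))"
    (is "M * (real q * x * (\<Sum>i\<le>N. ?f i)) = _ * (\<Sum>i\<le>N. ?g i)")
  proof -
    have "M * real q * ?f i = ?g i" if "i \<le> N" for i
    proof -
      have "M * real q * ?f i
         = K * real p ^ (N - 1) * real (N choose i) * ((-1) ^ i * dedekind_sum i (N - i) q p)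
           * (real q * real q ^ (N - 1) * ((x + 1) / q) ^ (N - i))"
        by (simp add: M_def mult_ac)
      then show ?thesis
        unfolding pow[OF assms(3) that] by (simp add: scaled_dedekind_def K_def mult_ac)
    qed
    then have "M * real q * (\<Sum>i\<le>N. ?f i) = (\<Sum>i\<le>N. ?g i)"
      unfolding sum_distrib_left by (intro sum.cong) auto
    then show ?thesis by (simp add: mult_ac)
  qed
  have 4: "M * (if N = 2 then x * 1 * (x + 1) / 2 else 0)
     = (if N = 2 then of_int (bernoulli_denom N * r_lcm N) / 2 * real p * real q * (x * (x + 1)) else 0)"
    by (simp add: M_def K_def)
  show ?thesis
    using rec assms unfolding right_diff_distrib[of M] distrib_left[of M] 1 2 3 4 by simp
qed

section \<open>Real polynomials with integer coefficients\<close>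

definition int_poly :: "real poly \<Rightarrow> bool" where
  "int_poly P \<longleftrightarrow> (\<forall>n. coeff P n \<in> \<int>)"

lemma int_poly_0: "int_poly 0"
  by (simp add: int_poly_def)

lemma int_poly_add: "int_poly P \<Longrightarrow> int_poly Q \<Longrightarrow> int_poly (P + Q)"
  by (simp add: int_poly_def)

lemma int_poly_diff: "int_poly P \<Longrightarrow> int_poly Q \<Longrightarrow> int_poly (P - Q)"
  by (simp add: int_poly_def)

lemma int_poly_mult: "int_poly P \<Longrightarrow> int_poly Q \<Longrightarrow> int_poly (P * Q)"
  by (auto simp: int_poly_def coeff_mult intro!: Ints_sum Ints_mult)

lemma int_poly_smult: "c \<in> \<int> \<Longrightarrow> int_poly P \<Longrightarrow> int_poly (smult c P)"
  by (auto simp: int_poly_def intro!: Ints_mult)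

lemma int_poly_pCons: "c \<in> \<int> \<Longrightarrow> int_poly P \<Longrightarrow> int_poly (pCons c P)"
  by (auto simp: int_poly_def coeff_pCons split: nat.split)

lemma int_poly_power: "int_poly P \<Longrightarrow> int_poly (P ^ n)"
  by (induction n) (auto intro: int_poly_mult simp: int_poly_pCons int_poly_0 one_pCons)

lemma int_poly_sum: "(\<And>i. i \<in> A \<Longrightarrow> int_poly (f i)) \<Longrightarrow> int_poly (sum f A)"
  by (induction A rule: infinite_finite_induct) (auto intro: int_poly_add int_poly_0)

lemmas int_poly_intros = int_poly_0 int_poly_add int_poly_diff int_poly_mult int_poly_smult
  int_poly_pCons int_poly_power int_poly_sum

lemma poly_eqI_pos:
  fixes P Q :: "real poly"
  assumes "\<And>x. x > 0 \<Longrightarrow> poly P x = poly Q x"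
  shows "P = Q"
proof (rule ccontr)
  assume "P \<noteq> Q"
  then have "finite {x. poly (P - Q) x = 0}" by (intro poly_roots_finite) simp
  moreover have "{0<..} \<subseteq> {x. poly (P - Q) x = 0}" using assms by auto
  ultimately have "finite {0::real<..}" by (rule rev_finite_subset)
  then show False by (simp add: infinite_Ioi)
qed

text \<open>Modulo \<open>q\<close> only the terms \<open>i = N\<close> of the first sum and \<open>i = 0\<close> of the second sum of the
  reciprocity law survive; they add up to \<open>(x + 1) ^ N * (p ^ N + x)\<close> times the leading constant.\<close>

lemma scaled_dedekind_cong_if:
  assumes "p > 0" "q > 0" "even N" "N > 0" "coprime p q" "i \<le> N"
    and int: "\<And>i. 1 \<le> i \<Longrightarrow> i < N \<Longrightarrow> scaled_dedekind N i q p \<in> \<int>"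
  obtains k :: int where "real p ^ i * scaled_dedekind N i p q
     = of_int (scaled_bernoulli N) * (real ((N - 1) choose (N - i)) * real p ^ N
         + (if i = N then 0 else real ((N - 1) choose i))) + of_int (int q * k)"
proof -
  define a where "a = real_of_int (scaled_bernoulli N)"
  define L where "L = ([:1, 1:] :: real poly)"
  define V where "V = (\<lambda>i. scaled_dedekind N i p q)"
  define V' where "V' = (\<lambda>i. scaled_dedekind N i q p)"
  define W where "W = (\<lambda>i. scaled_dedekind N i 1 1)"
  define F where "F = (\<Sum>i\<le>N. monom (real p ^ i * V i) (N - i))"
  \<comment> \<open>The two surviving terms, already divided by \<open>L\<close>.\<close>
  define G where "G = smult a (L ^ (N - 1) * [:real p ^ N, 1:])"
  define c where "c = (if N = 2 then of_int (bernoulli_denom N * r_lcm N) / 2 * real p else 0)"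
  \<comment> \<open>\<open>R1\<close>, \<open>R2\<close> and \<open>R3\<close> collect the remaining
    terms after a factor \<open>q\<close> has been taken out of each.\<close>
  define R1 where "R1 = (\<Sum>i<N. smult (W i * real q ^ (N - i - 1) * real p ^ i) (L ^ i * [:0, 1:] ^ (N - i)))"
  define R2 where "R2 = (\<Sum>i\<in>{1..N}. smult ((-1) ^ i * V' i * real q ^ (i - 1)) ([:0, 1:] * L ^ (N - i)))"
  define R3 where "R3 = smult c ([:0, 1:] * L)"
  have V'0: "V' 0 = a" and WN: "W N = a"
    unfolding V'_def W_def a_def using assms
    by (simp_all add: scaled_dedekind_0 scaled_dedekind_N coprime_commute)
  have V'int: "V' i \<in> \<int>" if le: "i \<le> N" for i
  proof -
    consider "i = 0" | "i = N" | "1 \<le> i" "i < N" using le by linarith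
    then show ?thesis
      by cases (use assms in \<open>auto simp: V'_def scaled_dedekind_0 scaled_dedekind_N coprime_commute intro: int\<close>)
  qed
  have Wint: "W i \<in> \<int>" if le: "i \<le> N" for i
  proof -
    consider "i = 0" | "i = N" | "1 \<le> i" "i < N" using le by linarith
    then show ?thesis
      by cases (use assms scaled_dedekind_1_int[of N i 1] in \<open>auto simp: W_def scaled_dedekind_0 scaled_dedekind_N\<close>)
  qed
  \<comment> \<open>The half in the correction term does no harm, since
    \<open>\<beta>_2 = 6\<close>.\<close>
  have cint: "c \<in> \<int>"
  proof (cases "N = 2")
    case True
    have "quotient_of (1/6) = quotient_of (Rat.Fract 1 6)" by (simp add: Rat.Fract_of_int_quotient)
    also have "\<dots> = (1, 6)" by (simp add: quotient_of_Fract Rat.normalize_def)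
    finally have "quotient_of (1/6) = (1, 6)" .
    then have "bernoulli_denom N = 6" by (simp add: True bernoulli_denom_def rat_denom_def bernoulli_2)
    then have "c = of_int (3 * r_lcm N * int p)" by (simp add: c_def True)
    then show ?thesis by (metis Ints_of_int)
  qed (simp add: c_def)
  have LF: "L * F = L * G + smult (real q) (R1 + R2 - R3)"
  proof (rule poly_eqI_pos)
    fix x :: real assume x: "x > 0"
    have pF: "poly F x = (\<Sum>i\<le>N. real p ^ i * V i * x ^ (N - i))"
      by (simp add: F_def poly_sum poly_monom)
    have p1: "(\<Sum>i\<le>N. W i * real q ^ (N - i) * real p ^ i * ((x + 1) ^ i * x ^ (N - i)))
        = a * real p ^ N * (x + 1) ^ N + real q * poly R1 x"
    proof -
      have split: "(\<Sum>i\<le>N. h i) = h N + (\<Sum>i<N. h i)" for h :: "nat \<Rightarrow> real"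
        by (simp flip: lessThan_Suc_atMost)
      have *: "W i * real q ^ (N - i) * real p ^ i * ((x + 1) ^ i * x ^ (N - i))
        = real q * (W i * real q ^ (N - i - 1) * real p ^ i * ((x + 1) ^ i * x ^ (N - i)))" if "i < N" for i
      proof -
        have "real q ^ (N - i) = real q * real q ^ (N - i - 1)" using that by (simp add: power_eq_if)
        then show ?thesis by simp
      qed
      have "(\<Sum>i<N. W i * real q ^ (N - i) * real p ^ i * ((x + 1) ^ i * x ^ (N - i))) = real q * poly R1 x"
        unfolding R1_def poly_sum sum_distrib_left
        by (intro sum.cong refl, subst *) (simp_all add: L_def add.commute)
      then show ?thesis by (simp add: split WN)
    qed
    have p2: "x * (\<Sum>i\<le>N. (-1) ^ i * V' i * real q ^ i * (x + 1) ^ (N - i))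
        = a * x * (x + 1) ^ N + real q * poly R2 x"
    proof -
      have split: "(\<Sum>i\<le>N. h i) = h 0 + (\<Sum>i\<in>{1..N}. h i)" for h :: "nat \<Rightarrow> real"
        by (simp add: atMost_atLeast0 sum.atLeast_Suc_atMost)
      have *: "x * ((-1) ^ i * V' i * real q ^ i * (x + 1) ^ (N - i))
        = real q * ((-1) ^ i * V' i * real q ^ (i - 1) * (x * (x + 1) ^ (N - i)))" if "i \<ge> 1" for i
      proof -
        have "real q ^ i = real q * real q ^ (i - 1)" using that by (simp add: power_eq_if)
        then show ?thesis by (simp add: mult_ac)
      qed
      have "(\<Sum>i\<in>{1..N}. x * ((-1) ^ i * V' i * real q ^ i * (x + 1) ^ (N - i))) = real q * poly R2 x"
        unfolding R2_def poly_sum sum_distrib_left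
        by (intro sum.cong refl, subst *) (simp_all add: L_def add.commute)
      then show ?thesis by (simp add: split V'0 distrib_left sum_distrib_left)
    qed
    have p3: "(if N = 2 then of_int (bernoulli_denom N * r_lcm N) / 2 * real p * real q * (x * (x + 1)) else 0)
        = real q * poly R3 x"
      by (simp add: R3_def L_def c_def algebra_simps)
    have "(x + 1) ^ N = (x + 1) * (x + 1) ^ (N - 1)" using assms by (simp add: power_eq_if)
    then have pG: "(x + 1) * poly G x = a * real p ^ N * (x + 1) ^ N + a * x * (x + 1) ^ N"
      by (simp add: G_def L_def algebra_simps)
    have rec: "(x + 1) * (\<Sum>i\<le>N. real p ^ i * V i * x ^ (N - i))
      = (\<Sum>i\<le>N. W i * real q ^ (N - i) * real p ^ i * ((x + 1) ^ i * x ^ (N - i)))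
        + x * (\<Sum>i\<le>N. (-1) ^ i * V' i * real q ^ i * (x + 1) ^ (N - i))
        - (if N = 2 then of_int (bernoulli_denom N * r_lcm N) / 2 * real p * real q * (x * (x + 1)) else 0)"
      unfolding V_def V'_def W_def by (rule scaled_reciprocity[OF x assms(1,2,4)])
    have "(x + 1) * poly F x = (x + 1) * poly G x + real q * (poly R1 x + poly R2 x - poly R3 x)"
      unfolding pF pG rec p1 p2 p3 by (simp add: algebra_simps)
    then show "poly (L * F) x = poly (L * G + smult (real q) (R1 + R2 - R3)) x"
      by (simp add: L_def algebra_simps)
  qed
  define R where "R = R1 + R2 - R3"
  define D where "D = F - G"
  have LD: "L * D = smult (real q) R"
    unfolding D_def R_def by (simp only: right_diff_distrib LF add_diff_cancel_left')
  have "int_poly R"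
    unfolding R_def R1_def R2_def R3_def L_def
    by (intro int_poly_intros Ints_mult Ints_power Wint V'int cint) auto
  then have "\<exists>k::int. coeff R n = of_int k" for n by (auto simp: int_poly_def elim: Ints_cases)
  then obtain \<rho> :: "nat \<Rightarrow> int" where \<rho>: "coeff R n = of_int (\<rho> n)" for n by metis
  \<comment> \<open>Division by \<open>L\<close> is possible over the integers because its constant
    coefficient is 1: the coefficients of \<open>D\<close> are determined one after the other from
    the lowest upwards, and divisibility by \<open>q\<close> is inherited.\<close>
  have Dn: "\<exists>k::int. coeff D n = of_int (int q * k)" for n
  proof (induction n)
    case 0
    have "coeff (L * D) 0 = coeff D 0" by (simp add: L_def)
    then have "coeff D 0 = of_int (int q * \<rho> 0)" using LD \<rho>[of 0] by simp
    then show ?case ..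
  next
    case (Suc n)
    then obtain k where "coeff D n = of_int (int q * k)" ..
    moreover have "coeff (L * D) (Suc n) = coeff D n + coeff D (Suc n)" by (simp add: L_def)
    ultimately have "coeff D (Suc n) = of_int (int q * (\<rho> (Suc n) - k))"
      using LD \<rho>[of "Suc n"] by (simp add: algebra_simps)
    then show ?case ..
  qed
  then obtain k where k: "coeff D (N - i) = of_int (int q * k)" by blast
  have "coeff F (N - i) = real p ^ i * V i"
  proof -
    have "coeff F (N - i) = (\<Sum>m\<le>N. if m = i then real p ^ m * V m else 0)"
      unfolding F_def coeff_sum by (intro sum.cong) (use assms(6) in auto)
    then show ?thesis using assms(6) by (simp add: sum.delta)
  qed
  moreover have "coeff G (N - i) = a * (real ((N - 1) choose (N - i)) * real p ^ N
         + (if i = N then 0 else real ((N - 1) choose i)))"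
  proof -
    have cL: "coeff (L ^ n) m = real (n choose m)" for n m
    proof (cases "m \<le> n")
      case False
      have "degree (L ^ n) \<le> n" using degree_power_le[of L n] by (simp add: L_def)
      then show ?thesis using False by (simp add: coeff_eq_0)
    qed (simp add: L_def coeff_linear_poly_power)
    have "L ^ (N - 1) * [:real p ^ N, 1:] = smult (real p ^ N) (L ^ (N - 1)) + pCons 0 (L ^ (N - 1))"
      by simp
    \<comment> \<open>For \<open>i = N\<close> this is the constant coefficient of a multiple of
      \<open>x\<close>, hence 0.\<close>
    moreover have "coeff (pCons 0 (L ^ (N - 1))) (N - i) = (if i = N then 0 else real ((N - 1) choose i))"
    proof (cases "i = N")
      case False
      then obtain m where m: "N - i = Suc m" using assms(6) by (cases "N - i") auto
      then have "m = N - 1 - i" "i \<le> N - 1" by auto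
      then have "(N - 1) choose m = (N - 1) choose i" by (simp add: binomial_symmetric)
      then show ?thesis using m False by (simp add: cL)
    qed simp
    ultimately show ?thesis by (simp add: G_def cL algebra_simps)
  qed
  ultimately show ?thesis using k that[of k] by (simp add: D_def V_def a_def algebra_simps)
qed

text \<open>The congruence bounds the denominator of \<open>scaled_dedekind N i p q\<close> by powers of both \<open>p\<close> and
  \<open>q - p\<close>, which are coprime.\<close>

lemma scaled_dedekind_int:
  assumes "even N" "q > 0" "p > 0" "coprime p q" "1 \<le> i" "i < N"
  shows "scaled_dedekind N i p q \<in> \<int>"
  using assms(2-)
proof (induction q arbitrary: p i rule: less_induct)
  case (less q)
  show ?case
  proof (cases "q = 1")
    case True
    then show ?thesis using scaled_dedekind_1_int[OF assms(1)] less.prems by simp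
  next
    case False
    \<comment> \<open>Once reduced, both \<open>p1\<close> and \<open>q - p1\<close> are smaller
      than \<open>q\<close>, so the induction hypothesis covers the reciprocal sums with these two
      moduli.\<close>
    define p1 where "p1 = p mod q"
    have cop: "coprime p1 q" using less.prems by (simp add: p1_def)
    have p1: "0 < p1" "p1 < q"
      using less.prems False cop by (auto simp: p1_def intro!: gr0I)
    have key: "\<exists>k::int. real r ^ i * scaled_dedekind N i r q = of_int k"
      if r: "0 < r" "r < q" "coprime r q" for r
    proof -
      have "scaled_dedekind N i' q r \<in> \<int>" if "1 \<le> i'" "i' < N" for i'
        using less.IH[of r q i'] r that by (simp add: coprime_commute)
      from scaled_dedekind_cong_if[OF r(1) less.prems(1) assms(1) _ r(3) _ this]
      obtain k where k: "real r ^ i * scaled_dedekind N i r q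
         = of_int (scaled_bernoulli N) * (real ((N - 1) choose (N - i)) * real r ^ N
         + (if i = N then 0 else real ((N - 1) choose i))) + of_int (int q * k)"
        using less.prems by (metis less_imp_le_nat less_nat_zero_code neq0_conv)
      have "real r ^ i * scaled_dedekind N i r q
         = of_int (scaled_bernoulli N * (int ((N - 1) choose (N - i)) * int r ^ N
         + (if i = N then 0 else int ((N - 1) choose i))) + int q * k)"
        unfolding k by simp
      then show ?thesis ..
    qed
    define V where "V = scaled_dedekind N i p1 q"
    obtain k1 where k1: "real p1 ^ i * V = of_int k1"
      using key[OF p1 cop] by (auto simp: V_def)
    have cop': "coprime (q - p1) q"
      using cop p1 by (metis coprime_commute coprime_diff_one_left_nat gcd_diff2_nat less_imp_le coprime_iff_gcd_eq_1 gcd.commute)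
    obtain k2 where k2: "real (q - p1) ^ i * scaled_dedekind N i (q - p1) q = of_int k2"
      using key[of "q - p1"] p1 cop' by auto
    \<comment> \<open>By reflection both sums are \<open>V\<close> up to sign, so that a power of
      \<open>p1\<close> and a power of \<open>q - p1\<close> clear the denominator of the same
      number.\<close>
    have "scaled_dedekind N i (q - p1) q = (-1) ^ (N - i) * V"
      using p1 by (simp add: scaled_dedekind_def V_def dedekind_sum_diff)
    with k2 have k3: "real (q - p1) ^ i * V = of_int ((-1) ^ (N - i) * k2)"
    proof -
      assume *: "scaled_dedekind N i (q - p1) q = (-1) ^ (N - i) * V"
      have "real (q - p1) ^ i * V = ((-1) ^ (N - i) * (-1) ^ (N - i)) * (real (q - p1) ^ i * V)"
        by (simp flip: power_mult_distrib)
      also have "\<dots> = (-1) ^ (N - i) * (real (q - p1) ^ i * ((-1) ^ (N - i) * V))"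
        by (simp only: mult_ac)
      finally have "real (q - p1) ^ i * V = (-1) ^ (N - i) * (real (q - p1) ^ i * ((-1) ^ (N - i) * V))" .
      then show ?thesis using k2 unfolding * by simp
    qed
    have "coprime p1 (q - p1)"
      using cop p1 by (metis add_diff_inverse_nat coprime_iff_gcd_eq_1 gcd_add2 less_imp_le_nat linorder_not_less)
    then have "coprime (int p1 ^ i) (int (q - p1) ^ i)" by simp
    then obtain s t where st: "s * int p1 ^ i + t * int (q - p1) ^ i = 1"
      by (metis coprime_iff_gcd_eq_1 bezout_int)
    have "V = of_int (s * int p1 ^ i + t * int (q - p1) ^ i) * V" by (simp only: st)
    also have "\<dots> = of_int s * (real p1 ^ i * V) + of_int t * (real (q - p1) ^ i * V)"
      by (simp add: algebra_simps)
    also have "\<dots> = of_int (s * k1 + t * ((-1) ^ (N - i) * k2))" by (simp add: k1 k3)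
    finally have "V \<in> \<int>" by (metis Ints_of_int)
    moreover have "dedekind_sum i (N - i) p q = dedekind_sum i (N - i) p1 q"
      using less.prems by (intro dedekind_sum_cong) (simp_all add: p1_def cong_def zmod_int)
    ultimately show ?thesis by (simp add: V_def scaled_dedekind_def)
  qed
qed

text \<open>The form needed for the exponential sums: the phase is \<open>u / q\<close> with an
  integer \<open>u\<close> that is determined modulo \<open>q\<close>. Keeping \<open>p ^ i\<close>
  on the left avoids inverses modulo \<open>q\<close>.\<close>

lemma scaled_dedekind_cong:
  assumes "i \<ge> 1" "j \<ge> 1" "even (i + j)" "p > 0" "q > 0" "coprime p q"
  obtains u :: int where
    "of_int (R_const i j) * real q ^ (i + j - 2) * dedekind_sum i j p q = of_int u / real q"
    "[int p ^ i * u = scaled_bernoulli (i + j) * (int ((i + j - 1) choose j) * int p ^ (i + j)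
        + int ((i + j - 1) choose i))] (mod int q)"
proof -
  define N where "N = i + j"
  have N: "even N" "i < N" "j = N - i" "N > 0" using assms by (auto simp: N_def)
  obtain u where u: "scaled_dedekind N i p q = of_int u"
    using scaled_dedekind_int[of N q p i] N assms by (auto elim: Ints_cases)
  have "scaled_dedekind N i' q p \<in> \<int>" if "1 \<le> i'" "i' < N" for i'
    using scaled_dedekind_int[of N p q i'] N assms that by (simp add: coprime_commute)
  then obtain k where "real p ^ i * scaled_dedekind N i p q
     = of_int (scaled_bernoulli N) * (real ((N - 1) choose (N - i)) * real p ^ N
         + (if i = N then 0 else real ((N - 1) choose i))) + of_int (int q * k)"
    using scaled_dedekind_cong_if[of p q N i] assms N by (metis less_imp_le_nat)
  then have "real_of_int (int p ^ i * u) = of_int (scaled_bernoulli N * (int ((N - 1) choose j) * int p ^ N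
         + int ((N - 1) choose i)) + int q * k)"
    using N by (simp add: u)
  then have "int p ^ i * u = scaled_bernoulli N * (int ((N - 1) choose j) * int p ^ N
         + int ((N - 1) choose i)) + int q * k"
    by (simp only: of_int_eq_iff)
  then have c: "[int p ^ i * u = scaled_bernoulli N * (int ((N - 1) choose j) * int p ^ N
         + int ((N - 1) choose i))] (mod int q)"
    by (simp add: cong_def)
  have "real q ^ (N - 1) = real q * real q ^ (N - 2)"
  proof -
    have "N - 1 = Suc (N - 2)" using assms N_def by auto
    then show ?thesis by simp
  qed
  then have "of_int (R_const i j) * real q ^ (N - 2) * dedekind_sum i j p q * real q = scaled_dedekind N i p q"
    by (simp add: scaled_dedekind_def R_const_def N_def mult_ac)
  then have "of_int (R_const i j) * real q ^ (N - 2) * dedekind_sum i j p q = of_int u / real q"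
    using assms u by (simp add: field_simps)
  then show ?thesis using that[of u] c unfolding N_def by blast
qed

section \<open>Non-vanishing of the Bernoulli numbers\<close>

text \<open>\<open>bgf 0 1\<close> is the expansion of \<open>t/2 coth(t/2)\<close>.\<close>

lemma bgf_ode:
  "fps_X * fps_deriv (bgf 0 1) = bgf 0 1 - (bgf 0 1)\<^sup>2 + fps_const (1/4) * fps_X\<^sup>2"
proof -
  define E where "E = fps_exp (1::real)"
  define f where "f = bgf 0 1"
  define h where "h = fps_const (1/2 :: real)"
  have h2: "2 * h = 1" and hh: "h * h = fps_const (1/4)" by (simp_all add: h_def numeral_fps_const)
  have f: "f * (E - 1) = h * fps_X * (E + 1)"
    using bgf_int[of 0 1] by (simp add: f_def E_def h_def)
  have "fps_deriv (f * (E - 1)) = fps_deriv (h * fps_X * (E + 1))" by (simp add: f)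
  then have f': "fps_deriv f * (E - 1) = h * (E + 1) + h * fps_X * E - f * E"
    by (simp add: E_def h_def algebra_simps)
  have L: "fps_X * fps_deriv f * ((E - 1) * (E - 1)) = fps_X * h * (E + 1) * (E - 1) - 2 * h * fps_X\<^sup>2 * E"
  proof -
    have "fps_X * fps_deriv f * ((E - 1) * (E - 1)) = fps_X * (E - 1) * (fps_deriv f * (E - 1))"
      by (simp add: mult_ac)
    also have "\<dots> = fps_X * (E - 1) * (h * (E + 1) + h * fps_X * E) - fps_X * E * (f * (E - 1))"
      unfolding f' by (simp add: algebra_simps)
    also have "\<dots> = fps_X * h * (E + 1) * (E - 1) - 2 * h * fps_X\<^sup>2 * E"
      unfolding f by (simp add: algebra_simps power2_eq_square)
    finally show ?thesis .
  qed
  have R: "(f - f\<^sup>2 + h * h * fps_X\<^sup>2) * ((E - 1) * (E - 1)) = fps_X * h * (E + 1) * (E - 1) - 2 * h * (2 * h) * fps_X\<^sup>2 * E"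
  proof -
    have "(f - f\<^sup>2 + h * h * fps_X\<^sup>2) * ((E - 1) * (E - 1))
        = (f * (E - 1)) * (E - 1) - (f * (E - 1)) * (f * (E - 1)) + h * h * fps_X\<^sup>2 * ((E - 1) * (E - 1))"
      by (simp add: algebra_simps power2_eq_square)
    then show ?thesis unfolding f by (simp add: algebra_simps power2_eq_square)
  qed
  have "(E - 1) * (E - 1) \<noteq> 0" using fps_exp_minus_1_nonzero[of "1::real"] by (simp add: E_def)
  moreover have "fps_X * fps_deriv f * ((E - 1) * (E - 1)) = (f - f\<^sup>2 + h * h * fps_X\<^sup>2) * ((E - 1) * (E - 1))"
    unfolding R L using h2 by simp
  ultimately show ?thesis by (simp add: f_def hh)
qed

text \<open>The differential equation gives
  \<open>(2m + 1) f(2m) = - (sum of f(2k) f(2m - 2k))\<close> over \<open>1 \<le> k < m\<close>. By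
  induction \<open>f(2k)\<close> has the sign \<open>(-1)^(k+1)\<close>, so every product has the
  sign \<open>(-1)^m\<close> and nothing can cancel.\<close>

lemma bernoulli_sign: "m \<ge> 1 \<Longrightarrow> (-1) ^ (m + 1) * periodic_bernoulli (2 * m) 0 > 0"
proof (induction m rule: less_induct)
  case (less m)
  define f where "f = (\<lambda>n. periodic_bernoulli n 0 / fact n)"
  have rec: "real n * f n = f n - (\<Sum>k\<le>n. f k * f (n - k)) + (if n = 2 then 1/4 else 0)" for n
  proof -
    have "(fps_X * fps_deriv (bgf 0 1)) $ n = real n * f n"
      by (cases n) (simp_all add: bgf_nth f_def)
    moreover have "(bgf 0 1)\<^sup>2 $ n = (\<Sum>k\<le>n. f k * f (n - k))"
      by (simp add: power2_eq_square fps_mult_nth atLeast0AtMost bgf_nth f_def)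
    moreover have "(fps_const (1/4) * fps_X\<^sup>2) $ n = (if n = 2 then 1/4 else (0::real))"
      by (simp add: fps_X_power_nth)
    ultimately show ?thesis
      using arg_cong[OF bgf_ode, of "\<lambda>g. g $ n"] unfolding fps_add_nth fps_sub_nth
      by (simp add: bgf_nth f_def)
  qed
  show ?case
  proof (cases "m = 1")
    case True
    \<comment> \<open>Degree 2 is the only one that the inhomogeneous term \<open>t^2 / 4\<close>
      affects.\<close>
    then show ?thesis by (simp add: periodic_bernoulli_even bernoulli_2 of_rat_divide)
  next
    case False
    have f0: "f 0 = 1" by (simp add: f_def periodic_bernoulli_0)
    have split: "{..2 * m} = insert 0 (insert (2 * m) {1..<2 * m})" using less.prems by auto
    have "(\<Sum>k\<le>2 * m. f k * f (2 * m - k)) = 2 * f (2 * m) + (\<Sum>k\<in>{1..<2 * m}. f k * f (2 * m - k))"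
      unfolding split using less.prems by (simp add: f0)
    then have eq: "(real (2 * m) + 1) * f (2 * m) = - (\<Sum>k\<in>{1..<2 * m}. f k * f (2 * m - k))"
      using rec[of "2 * m"] False by (simp add: algebra_simps)
    have pos: "(-1) ^ m * (f (2 * k) * f (2 * m - 2 * k)) > 0" if "1 \<le> k" "k < m" for k
    proof -
      have "(-1) ^ (l + 1) * f (2 * l) > 0" if "1 \<le> l" "l < m" for l
        using divide_pos_pos[OF less.IH[OF that(2,1)] fact_gt_zero]
        by (simp only: f_def times_divide_eq_right)
      from this[of k] this[of "m - k"] that
      have "(-1) ^ (k + 1) * f (2 * k) > 0" "(-1) ^ (m - k + 1) * f (2 * (m - k)) > 0"
        by auto
      then have "0 < ((-1) ^ (k + 1) * f (2 * k)) * ((-1) ^ (m - k + 1) * f (2 * (m - k)))"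
        by (rule mult_pos_pos)
      also have "\<dots> = (-1) ^ (k + 1 + (m - k + 1)) * (f (2 * k) * f (2 * (m - k)))"
        by (simp add: power_add)
      also have "k + 1 + (m - k + 1) = m + 2" using that by simp
      finally show ?thesis by (simp add: diff_mult_distrib2)
    qed
    have "0 < (\<Sum>k\<in>{1..<2 * m}. (-1) ^ m * (f k * f (2 * m - k)))"
    proof (rule sum_pos2[of _ 2])
      show "0 < (-1) ^ m * (f 2 * f (2 * m - 2))" using pos[of 1] False less.prems by simp
      fix k assume k: "k \<in> {1..<2 * m}"
      show "0 \<le> (-1) ^ m * (f k * f (2 * m - k))"
      proof (cases "even k")
        case True
        then obtain l where l: "k = 2 * l" by (elim evenE)
        then show ?thesis using pos[of l] k by simp
      qed (simp add: f_def periodic_bernoulli_odd)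
    qed (use False less.prems in auto)
    also have "\<dots> = (real (2 * m) + 1) * ((-1) ^ (m + 1) * f (2 * m))"
    proof -
      have "(real (2 * m) + 1) * ((-1) ^ (m + 1) * f (2 * m)) = (-1) ^ (m + 1) * ((real (2 * m) + 1) * f (2 * m))"
        by (simp only: mult_ac)
      then show ?thesis unfolding eq sum_distrib_left[symmetric] by simp
    qed
    finally have "(-1) ^ (m + 1) * f (2 * m) > 0"
      by (rule zero_less_mult_pos) simp
    then show ?thesis by (simp add: f_def divide_less_0_iff)
  qed
qed

lemma scaled_bernoulli_nonzero:
  assumes "even N" "N > 0"
  shows "scaled_bernoulli N \<noteq> 0"
proof -
  obtain m where m: "N = 2 * m" using assms by (elim evenE)
  then have "periodic_bernoulli N 0 \<noteq> 0" using bernoulli_sign[of m] assms by auto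
  moreover have "r_lcm N \<noteq> 0"
  proof -
    \<comment> \<open>The image form shows that the set is finite; the \<open>Lcm\<close> of an
      infinite set of integers would be 0.\<close>
    have "r_lcm N = Lcm ((\<lambda>i. rat_denom (of_int (bernoulli_denom N) * of_nat (N choose (i + 1)) *
                     bernoulli (i + 1) * bernoulli (N - i - 1))) ` {i. odd i \<and> i \<le> N - 2})"
      unfolding r_lcm_def by (rule arg_cong[of _ _ Lcm]) auto
    moreover have "0 \<notin> range rat_denom" using rat_denom_pos by (metis less_irrefl rangeE)
    ultimately show ?thesis by (auto simp: Lcm_0_iff)
  qed
  moreover have "bernoulli_denom N \<noteq> 0" using rat_denom_pos[of "bernoulli N"] by (simp add: bernoulli_denom_def)
  ultimately have "real_of_int (scaled_bernoulli N) \<noteq> 0" using scaled_bernoulli_eq[OF assms(1)] by simp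
  then show ?thesis by simp
qed

section \<open>Kloosterman sums with powers\<close>

definition root_exp :: "nat \<Rightarrow> int \<Rightarrow> complex" where
  "root_exp q k = cis (2 * pi * (of_int k / of_nat q))"

lemma root_exp_add: "root_exp q (a + b) = root_exp q a * root_exp q b"
  by (simp add: root_exp_def cis_mult add_divide_distrib distrib_left)

lemma root_exp_minus: "root_exp q (- a) = cnj (root_exp q a)"
  by (simp add: root_exp_def cis_cnj)

lemma norm_root_exp [simp]: "norm (root_exp q a) = 1"
  by (simp add: root_exp_def)

lemma root_exp_eq_1_iff:
  assumes "q > 0"
  shows "root_exp q k = 1 \<longleftrightarrow> int q dvd k"
proof
  assume "root_exp q k = 1"
  then obtain n where "2 * pi * (of_int k / of_nat q) = of_int n * (2 * pi)"
    by (auto simp: root_exp_def cis_eq_1_iff)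
  then have "of_int k = real_of_int (int q * n)" using assms by (simp add: field_simps)
  then have "k = int q * n" by (simp only: of_int_eq_iff)
  then show "int q dvd k" by simp
next
  assume "int q dvd k"
  then obtain n where "k = int q * n" by (elim dvdE)
  then have "of_int k / of_nat q = real_of_int n" using assms by simp
  then show "root_exp q k = 1" unfolding root_exp_def by (simp only:) simp
qed

lemma root_exp_cong:
  assumes "q > 0" "[a = b] (mod int q)"
  shows "root_exp q a = root_exp q b"
proof -
  have "int q dvd a - b" using assms by (simp add: cong_iff_dvd_diff)
  then have "root_exp q (a - b) = 1" using assms by (simp add: root_exp_eq_1_iff)
  then show ?thesis using root_exp_add[of q "a - b" b] by simp
qed

lemma root_exp_mult_nat: "root_exp q (int n * k) = root_exp q k ^ n"
  by (induction n) (simp_all add: distrib_right root_exp_add, simp add: root_exp_def)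

lemma sum_root_exp:
  assumes "q > 0"
  shows "(\<Sum>a<q. root_exp q (int a * k)) = (if int q dvd k then of_nat q else 0)"
proof (cases "int q dvd k")
  case True
  then have "root_exp q (int a * k) = 1" for a using assms by (simp add: root_exp_eq_1_iff)
  then show ?thesis using True by simp
next
  case False
  have "root_exp q k ^ q = 1"
    using assms by (simp add: root_exp_eq_1_iff flip: root_exp_mult_nat)
  moreover have "root_exp q k \<noteq> 1" using False assms by (simp add: root_exp_eq_1_iff)
  ultimately show ?thesis using False
    by (simp add: root_exp_mult_nat sum_gp_strict)
qed

text \<open>After expanding the square, orthogonality in \<open>a\<close> and in \<open>b\<close>
  keeps just the pairs that satisfy both congruences, each with weight \<open>l^2\<close>. Moments
  thereby become solution counts.\<close>

lemma sum_norm_power2_root_exp: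
  fixes \<phi> \<psi> :: "'a \<Rightarrow> int"
  assumes "l > 0" "finite A"
  shows "(\<Sum>a<l. \<Sum>b<l. (norm (\<Sum>z\<in>A. root_exp l (int a * \<phi> z + int b * \<psi> z)))\<^sup>2)
    = real l ^ 2 * real (card {(z, z') \<in> A \<times> A. [\<phi> z = \<phi> z'] (mod int l) \<and> [\<psi> z = \<psi> z'] (mod int l)})"
proof -
  let ?S = "{(z, z') \<in> A \<times> A. [\<phi> z = \<phi> z'] (mod int l) \<and> [\<psi> z = \<psi> z'] (mod int l)}"
  let ?e = "\<lambda>a b z z'. root_exp l (int a * (\<phi> z - \<phi> z')) * root_exp l (int b * (\<psi> z - \<psi> z'))"
  have sq: "complex_of_real ((norm (\<Sum>z\<in>A. root_exp l (int a * \<phi> z + int b * \<psi> z)))\<^sup>2)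
     = (\<Sum>z\<in>A. \<Sum>z'\<in>A. ?e a b z z')" for a b
  proof -
    have "complex_of_real ((norm (\<Sum>z\<in>A. root_exp l (int a * \<phi> z + int b * \<psi> z)))\<^sup>2)
      = (\<Sum>z\<in>A. root_exp l (int a * \<phi> z + int b * \<psi> z)) * (\<Sum>z\<in>A. root_exp l (- (int a * \<phi> z + int b * \<psi> z)))"
      unfolding complex_norm_square root_exp_minus cnj_sum ..
    also have "\<dots> = (\<Sum>z\<in>A. \<Sum>z'\<in>A. root_exp l (int a * \<phi> z + int b * \<psi> z) * root_exp l (- (int a * \<phi> z' + int b * \<psi> z')))"
      by (rule sum_product)
    also have "\<dots> = (\<Sum>z\<in>A. \<Sum>z'\<in>A. ?e a b z z')"
      by (intro sum.cong refl, unfold root_exp_add[symmetric]) (simp add: algebra_simps)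
    finally show ?thesis .
  qed
  have "complex_of_real (\<Sum>a<l. \<Sum>b<l. (norm (\<Sum>z\<in>A. root_exp l (int a * \<phi> z + int b * \<psi> z)))\<^sup>2)
      = (\<Sum>a<l. \<Sum>b<l. \<Sum>z\<in>A. \<Sum>z'\<in>A. ?e a b z z')"
    unfolding of_real_sum sq ..
  also have "\<dots> = (\<Sum>a<l. \<Sum>z\<in>A. \<Sum>z'\<in>A. \<Sum>b<l. ?e a b z z')"
    by (subst sum.swap, subst (2) sum.swap) (rule refl)
  also have "\<dots> = (\<Sum>z\<in>A. \<Sum>z'\<in>A. \<Sum>a<l. \<Sum>b<l. ?e a b z z')"
    by (subst sum.swap, subst (2) sum.swap) (rule refl)
  also have "\<dots> = (\<Sum>z\<in>A. \<Sum>z'\<in>A. if (z, z') \<in> ?S then of_nat l ^ 2 else 0)"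
  proof (intro sum.cong refl)
    fix z z' assume "z \<in> A" "z' \<in> A"
    have "(\<Sum>a<l. \<Sum>b<l. ?e a b z z')
      = (\<Sum>a<l. root_exp l (int a * (\<phi> z - \<phi> z'))) * (\<Sum>b<l. root_exp l (int b * (\<psi> z - \<psi> z')))"
      by (simp add: sum_product)
    then show "(\<Sum>a<l. \<Sum>b<l. ?e a b z z') = (if (z, z') \<in> ?S then of_nat l ^ 2 else 0)"
      using assms \<open>z \<in> A\<close> \<open>z' \<in> A\<close>
      by (auto simp: sum_root_exp cong_iff_dvd_diff power2_eq_square)
  qed
  also have "\<dots> = (\<Sum>x\<in>A \<times> A. if x \<in> ?S then of_nat l ^ 2 else 0)"
    unfolding sum.cartesian_product by (intro sum.cong refl) (auto split: if_splits)
  also have "\<dots> = (\<Sum>x\<in>?S. of_nat l ^ 2)"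
    using assms by (intro sum.mono_neutral_cong_right) auto
  also have "\<dots> = complex_of_real (real l ^ 2 * real (card ?S))" by simp
  finally show ?thesis by (simp only: of_real_eq_iff)
qed

section \<open>Solutions of polynomial congruences modulo a prime\<close>

lemma card_roots_mod_prime:
  fixes P :: "int poly"
  assumes "prime l" "degree P \<le> n" "\<not> int l dvd coeff P n"
  shows "card {x. x < l \<and> int l dvd poly P (int x)} \<le> n"
  using assms(2,3)
proof (induction n arbitrary: P)
  case 0
  then obtain c where P: "P = [:c:]" by (metis le_zero_eq degree_eq_zeroE)
  then have "{x. x < l \<and> int l dvd poly P (int x)} = {}" using 0 by auto
  then show ?case by (metis card.empty le_refl)
next
  case (Suc n)
  let ?Z = "\<lambda>P. {x. x < l \<and> int l dvd poly P (int x)}"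
  show ?case
  proof (cases "?Z P = {}")
    case False
    then obtain r where r: "r < l" "int l dvd poly P (int r)" by auto
    define Q where "Q = synthetic_div P (int r)"
    \<comment> \<open>The root is split off over the integers. The remainder \<open>P(r)\<close>
      vanishes only modulo \<open>l\<close>, and the coefficient of degree \<open>n + 1\<close>
      passes unchanged to degree \<open>n\<close> of \<open>Q\<close>.\<close>
    have PQ: "P = [:- int r, 1:] * Q + [:poly P (int r):]"
      unfolding Q_def by (rule synthetic_div_correct'[symmetric])
    have dQ: "degree Q \<le> n" using Suc.prems by (simp add: Q_def degree_synthetic_div)
    then have "coeff P (Suc n) = coeff Q n"
      by (subst PQ) (simp add: coeff_eq_0)
    then have IH: "card (?Z Q) \<le> n" using Suc.IH[OF dQ] Suc.prems by simp
    have "?Z P \<subseteq> insert r (?Z Q)"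
    proof
      fix x assume x: "x \<in> ?Z P"
      have "poly P (int x) = (int x - int r) * poly Q (int x) + poly P (int r)"
        by (subst PQ) (simp add: algebra_simps)
      then have "int l dvd (int x - int r) * poly Q (int x)"
        using x r by (metis (mono_tags, lifting) dvd_add_left_iff mem_Collect_eq)
      then have "int l dvd int x - int r \<or> int l dvd poly Q (int x)"
        using assms(1) by (simp add: prime_dvd_mult_iff)
      moreover have "x = r" if "int l dvd int x - int r"
        using that x r by (simp add: cong_iff_dvd_diff[symmetric] cong_int_iff cong_less_modulus_unique_nat)
      ultimately show "x \<in> insert r (?Z Q)" using x by auto
    qed
    then have "card (?Z P) \<le> card (insert r (?Z Q))" by (intro card_mono) auto
    also have "\<dots> \<le> Suc (card (?Z Q))" by (simp add: card_insert_if)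
    finally show ?thesis using IH by simp
  next
    case True
    then show ?thesis by (metis card.empty le0)
  qed
qed

lemma card_power_roots_mod_prime:
  assumes "prime l" "j \<ge> 1"
  shows "card {x. x < l \<and> [int x ^ j = c] (mod int l)} \<le> j"
proof -
  let ?P = "monom 1 j - [:c:]"
  have "degree ?P \<le> j" by (intro degree_diff_le) (auto simp: degree_monom_le)
  moreover have "coeff ?P j = 1" using assms by (cases j) auto
  moreover have "\<not> int l dvd 1" using prime_gt_1_nat[OF assms(1)] by simp
  ultimately have "card {x. x < l \<and> int l dvd poly ?P (int x)} \<le> j"
    using card_roots_mod_prime[OF assms(1), of ?P j] by simp
  then show ?thesis by (simp add: cong_iff_dvd_diff poly_monom)
qed

lemma card_Sigma_le:
  assumes "finite A" "card A \<le> m" "\<And>x. x \<in> A \<Longrightarrow> finite (B x)" "\<And>x. x \<in> A \<Longrightarrow> card (B x) \<le> n"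
  shows "card (Sigma A B) \<le> m * n"
proof -
  have "card (Sigma A B) = (\<Sum>x\<in>A. card (B x))" using assms by (simp add: card_SigmaI)
  also have "\<dots> \<le> card A * n" using sum_bounded_above[of A "\<lambda>x. card (B x)" n] assms(4) by simp
  also have "\<dots> \<le> m * n" using assms(2) by simp
  finally show ?thesis .
qed

lemma modular_inverse_cong_1:
  assumes "prime l" "u \<in> {1..<l}"
  shows "[int u * modular_inverse (int l) (int u) = 1] (mod int l)"
proof -
  have "\<not> l dvd u" using assms by (auto dest: dvd_imp_le)
  then have "coprime (int u) (int l)"
    using assms(1) by (simp add: coprime_commute prime_imp_coprime)
  then show ?thesis by (rule cong_modular_inverse1)
qed

lemma cong_sum_inverse_powers:
  fixes x y v w :: int
  assumes "[x * v = 1] (mod m)" "[y * w = 1] (mod m)" "[v ^ i + w ^ i = d] (mod m)"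
  shows "[x ^ i * y ^ i * d = y ^ i + x ^ i] (mod m)"
proof -
  have "[x ^ i * y ^ i * d = x ^ i * y ^ i * (v ^ i + w ^ i)] (mod m)"
    by (intro cong_mult cong_refl cong_sym[OF assms(3)])
  also have "x ^ i * y ^ i * (v ^ i + w ^ i) = (x * v) ^ i * y ^ i + (y * w) ^ i * x ^ i"
    by (simp add: power_mult_distrib algebra_simps)
  also have "[\<dots> = 1 ^ i * y ^ i + 1 ^ i * x ^ i] (mod m)"
    by (intro cong_add cong_mult cong_pow assms cong_refl)
  finally show ?thesis by simp
qed

text \<open>Eliminating \<open>y\<close> from the two equations leaves a polynomial equation in \<open>x\<close> of degree \<open>2 i j\<close>
  whose leading coefficient is \<open>d ^ j\<close> up to sign.\<close>

lemma card_inverse_power_pairs: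
  fixes w :: "nat \<Rightarrow> int"
  assumes l: "prime l" and i: "i \<ge> 1" and j: "j \<ge> 1" and d: "\<not> int l dvd d"
    and w: "\<And>u. u \<in> {1..<l} \<Longrightarrow> [int u * w u = 1] (mod int l)"
  shows "card {(x, y) \<in> {1..<l} \<times> {1..<l}. [w x ^ i + w y ^ i = d] (mod int l) \<and>
           [int x ^ j + int y ^ j = c] (mod int l)} \<le> 2 * (i * j) * j"
    (is "card ?S \<le> _")
proof -
  \<comment> \<open>\<open>F\<close> represents \<open>y^j\<close>, and the first equation reads
    \<open>y^i G = x^i\<close>. Writing \<open>y^(ij)\<close> through both gives
    \<open>F^i G^j = x^(ij)\<close>.\<close>
  define F where "F = [:c:] - monom 1 j"
  define G where "G = monom d i - 1"
  define P where "P = F ^ i * G ^ j - monom 1 (i * j)"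
  have d0: "d \<noteq> 0" using d by auto
  have degF: "degree F = j"
  proof -
    have "degree (monom 1 j + [:- c:]) = j"
      using j by (subst degree_add_eq_left) (auto simp: degree_monom_eq)
    then have "degree (- (monom 1 j + [:- c:])) = j" by (simp only: degree_minus)
    then show ?thesis by (simp add: F_def)
  qed
  have cF: "coeff F j = -1" using j by (cases j) (auto simp: F_def)
  have degG: "degree G = i"
  proof -
    have "G = monom d i + [:- 1:]" by (simp add: G_def one_pCons)
    also have "degree \<dots> = i" using i d0 by (simp add: degree_add_eq_left degree_monom_eq)
    finally show ?thesis .
  qed
  have cG: "coeff G i = d" using i by (cases i) (auto simp: G_def)
  have F0: "F \<noteq> 0" using cF by auto
  have G0: "G \<noteq> 0" using cG d0 by auto
  have dF: "degree (F ^ i) = i * j" using degree_power_eq[OF F0] degF by simp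
  have dG: "degree (G ^ j) = i * j" using degree_power_eq[OF G0] degG by simp
  have "degree P \<le> 2 * (i * j)"
  proof -
    have "degree (F ^ i * G ^ j) \<le> 2 * (i * j)" using degree_mult_le[of "F ^ i" "G ^ j"] dF dG by simp
    moreover have "degree (monom (1::int) (i * j)) \<le> 2 * (i * j)"
      by (rule order_trans[OF degree_monom_le]) simp
    ultimately show ?thesis unfolding P_def by (rule degree_diff_le)
  qed
  moreover have "coeff P (2 * (i * j)) = (-1) ^ i * d ^ j"
  proof -
    have "coeff (F ^ i * G ^ j) (2 * (i * j)) = lead_coeff (F ^ i) * lead_coeff (G ^ j)"
      using coeff_mult_degree_sum[of "F ^ i" "G ^ j"] by (simp add: dF dG mult_2)
    also have "\<dots> = (-1) ^ i * d ^ j" by (simp add: lead_coeff_power degF degG cF cG)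
    finally show ?thesis using i j by (simp add: P_def)
  qed
  moreover have "\<not> int l dvd (-1) ^ i * d ^ j"
  proof
    assume "int l dvd (-1) ^ i * d ^ j"
    then have "int l dvd d ^ j" by (cases "even i") auto
    then show False using l d prime_dvd_power[of "int l" d j] by simp
  qed
  ultimately have cP: "card {x. x < l \<and> int l dvd poly P (int x)} \<le> 2 * (i * j)"
    using card_roots_mod_prime[OF l, of P "2 * (i * j)"] by simp
  have "?S \<subseteq> Sigma {x. x < l \<and> int l dvd poly P (int x)}
       (\<lambda>x. {y. y < l \<and> [int y ^ j = c - int x ^ j] (mod int l)})"
  proof safe
    fix x y assume xy: "x \<in> {1..<l}" "y \<in> {1..<l}"
      and e1: "[w x ^ i + w y ^ i = d] (mod int l)" and e2: "[int x ^ j + int y ^ j = c] (mod int l)"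
    show "x < l" "y < l" using xy by auto
    show yj: "[int y ^ j = c - int x ^ j] (mod int l)"
      using cong_diff[OF e2 cong_refl[of "int x ^ j"]] by simp
    let ?X = "int x" and ?Y = "int y"
    have "[?X ^ i * ?Y ^ i * d = ?Y ^ i + ?X ^ i] (mod int l)"
      by (rule cong_sum_inverse_powers[OF w[OF xy(1)] w[OF xy(2)] e1])
    from cong_diff[OF this cong_refl[of "?Y ^ i"]]
    have "[?Y ^ i * (d * ?X ^ i - 1) = ?X ^ i] (mod int l)" by (simp add: algebra_simps)
    from cong_pow[OF this, of j]
    have "[(?Y ^ j) ^ i * (d * ?X ^ i - 1) ^ j = ?X ^ (i * j)] (mod int l)"
      by (simp add: power_mult_distrib mult.commute flip: power_mult)
    moreover have "[(?Y ^ j) ^ i * (d * ?X ^ i - 1) ^ j = (c - ?X ^ j) ^ i * (d * ?X ^ i - 1) ^ j] (mod int l)"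
      by (intro cong_mult cong_pow yj cong_refl)
    ultimately have "[(c - ?X ^ j) ^ i * (d * ?X ^ i - 1) ^ j = ?X ^ (i * j)] (mod int l)"
      by (metis cong_sym cong_trans)
    then show "int l dvd poly P ?X"
      by (simp add: P_def F_def G_def poly_monom cong_iff_dvd_diff)
  qed
  then have "card ?S \<le> card (Sigma {x. x < l \<and> int l dvd poly P (int x)}
       (\<lambda>x. {y. y < l \<and> [int y ^ j = c - int x ^ j] (mod int l)}))"
    by (intro card_mono finite_SigmaI) auto
  also have "\<dots> \<le> 2 * (i * j) * j"
    by (intro card_Sigma_le cP card_power_roots_mod_prime l j) auto
  finally show ?thesis .
qed

text \<open>If \<open>\<phi> z'\<close> is nonzero modulo \<open>l\<close>, the previous count
  leaves at most \<open>2 i j^2\<close> choices of \<open>z\<close>. The degenerate case has to be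
  counted differently: then \<open>z\<close> and \<open>z'\<close> both lie in the zero set
  \<open>Z\<close>, where \<open>y^i = -x^i\<close>, so that \<open>Z\<close> has at most
  \<open>i l\<close> elements.\<close>

lemma card_additive_quadruples:
  fixes w :: "nat \<Rightarrow> int"
  assumes l: "prime l" and i: "i \<ge> 1" and j: "j \<ge> 1"
    and w: "\<And>u. u \<in> {1..<l} \<Longrightarrow> [int u * w u = 1] (mod int l)"
  defines "A \<equiv> {1..<l} \<times> {1..<l}"
  defines "\<phi> \<equiv> \<lambda>(x, y). w x ^ i + w y ^ i"
  defines "\<psi> \<equiv> \<lambda>(x, y). int x ^ j + int y ^ j"
  shows "card {(z, z') \<in> A \<times> A. [\<phi> z = \<phi> z'] (mod int l) \<and> [\<psi> z = \<psi> z'] (mod int l)}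
    \<le> (2 * i * j ^ 2 + i ^ 2) * l ^ 2"
    (is "card ?S \<le> _")
proof -
  define Z where "Z = {z \<in> A. int l dvd \<phi> z}"
  define T where "T = (SIGMA z':A - Z. {z \<in> A. [\<phi> z = \<phi> z'] (mod int l) \<and> [\<psi> z = \<psi> z'] (mod int l)})"
  have finA: "finite A" by (simp add: A_def)
  have cA: "card A \<le> l * l" by (simp add: A_def card_cartesian_product mult_le_mono)
  have cZ: "card Z \<le> l * i"
  proof -
    have "Z \<subseteq> (SIGMA x:{..<l}. {y. y < l \<and> [int y ^ i = - (int x ^ i)] (mod int l)})"
    proof safe
      fix x y assume "(x, y) \<in> Z"
      then have xy: "x \<in> {1..<l}" "y \<in> {1..<l}" and z: "[w x ^ i + w y ^ i = 0] (mod int l)"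
        by (auto simp: Z_def A_def \<phi>_def cong_0_iff)
      show "x < l" "y < l" using xy by auto
      let ?X = "int x" and ?Y = "int y"
      have "[0 = ?Y ^ i + ?X ^ i] (mod int l)"
        using cong_sum_inverse_powers[OF w[OF xy(1)] w[OF xy(2)] z] by simp
      from cong_diff[OF cong_sym[OF this] cong_refl[of "?X ^ i"]]
      show "[?Y ^ i = - (?X ^ i)] (mod int l)" by simp
    qed
    then have "card Z \<le> card (SIGMA x:{..<l}. {y. y < l \<and> [int y ^ i = - (int x ^ i)] (mod int l)})"
      by (intro card_mono finite_SigmaI) auto
    also have "\<dots> \<le> l * i"
      by (intro card_Sigma_le card_power_roots_mod_prime l i) auto
    finally show ?thesis .
  qed
  have finT: "finite T" unfolding T_def using finA by (intro finite_SigmaI) auto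
  have cT: "card T \<le> (l * l) * (2 * (i * j) * j)"
    unfolding T_def
  proof (rule card_Sigma_le)
    show "card (A - Z) \<le> l * l" using card_mono[OF finA, of "A - Z"] cA by auto
    fix z' assume "z' \<in> A - Z"
    then have "\<not> int l dvd \<phi> z'" by (auto simp: Z_def)
    note bound = card_inverse_power_pairs[OF l i j this w, of "\<psi> z'"]
    have set_eq: "{z \<in> A. [\<phi> z = \<phi> z'] (mod int l) \<and> [\<psi> z = \<psi> z'] (mod int l)}
        = {(x, y) \<in> {1..<l} \<times> {1..<l}. [w x ^ i + w y ^ i = \<phi> z'] (mod int l) \<and>
           [int x ^ j + int y ^ j = \<psi> z'] (mod int l)}"
      unfolding A_def \<phi>_def \<psi>_def by auto
    show "card {z \<in> A. [\<phi> z = \<phi> z'] (mod int l) \<and> [\<psi> z = \<psi> z'] (mod int l)} \<le> 2 * (i * j) * j"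
      unfolding set_eq by (rule bound)
  qed (use finA in auto)
  have "?S \<subseteq> Z \<times> Z \<union> prod.swap ` T"
  proof
    fix s assume "s \<in> ?S"
    then obtain z z' where s: "s = (z, z')" "z \<in> A" "z' \<in> A" "[\<phi> z = \<phi> z'] (mod int l)" "[\<psi> z = \<psi> z'] (mod int l)"
      by auto
    show "s \<in> Z \<times> Z \<union> prod.swap ` T"
    proof (cases "z' \<in> Z")
      case True
      then have "z \<in> Z" using s by (simp add: Z_def cong_dvd_iff)
      then show ?thesis using True s by simp
    next
      case False
      then have "(z', z) \<in> T" using s by (simp add: T_def)
      then have "prod.swap (z', z) \<in> prod.swap ` T" by (rule imageI)
      then show ?thesis using s by simp
    qed
  qed
  then have "card ?S \<le> card (Z \<times> Z \<union> prod.swap ` T)"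
    using finA finT by (intro card_mono) (auto simp: Z_def)
  also have "\<dots> \<le> card (Z \<times> Z) + card T"
    by (rule order_trans[OF card_Un_le]) (simp add: card_image_le finT)
  also have "\<dots> \<le> (l * i) * (l * i) + (l * l) * (2 * (i * j) * j)"
    by (intro add_mono cT) (simp only: card_cartesian_product mult_le_mono cZ)
  also have "\<dots> = (2 * i * j ^ 2 + i ^ 2) * l ^ 2"
    by (simp add: power2_eq_square algebra_simps)
  finally show ?thesis .
qed

text \<open>The classical Kloosterman sum is the case \<open>i = j = 1\<close>.\<close>

definition kloosterman :: "nat \<Rightarrow> nat \<Rightarrow> nat \<Rightarrow> int \<Rightarrow> int \<Rightarrow> complex" where
  "kloosterman l i j a b =
     (\<Sum>u\<in>{1..<l}. root_exp l (a * modular_inverse (int l) (int u) ^ i + b * int u ^ j))"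

lemma kloosterman_cong:
  assumes "l > 0" "[a = a'] (mod int l)" "[b = b'] (mod int l)"
  shows "kloosterman l i j a b = kloosterman l i j a' b'"
  unfolding kloosterman_def
  by (intro sum.cong refl root_exp_cong assms cong_add cong_mult cong_refl)

lemma cong_inverse_unique:
  fixes t x y :: int
  assumes "[t * x = 1] (mod m)" "[t * y = 1] (mod m)"
  shows "[x = y] (mod m)"
proof -
  have "[x * (t * y) = x * 1] (mod m)" by (intro cong_mult assms cong_refl)
  moreover have "[y * (t * x) = y * 1] (mod m)" by (intro cong_mult assms cong_refl)
  moreover have "x * (t * y) = y * (t * x)" by simp
  ultimately show ?thesis by (metis cong_sym cong_trans mult.right_neutral)
qed

lemma bij_betw_mult_mod_prime:
  fixes l t :: nat
  assumes l: "prime l" and t: "t \<in> {1..<l}"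
  shows "bij_betw (\<lambda>u. (t * u) mod l) {1..<l} {1..<l}"
proof -
  have nd: "\<not> l dvd u" if "u \<in> {1..<l}" for u using that by (auto dest: dvd_imp_le)
  have "inj_on (\<lambda>u. (t * u) mod l) {1..<l}"
  proof (rule inj_onI)
    fix x y assume xy: "x \<in> {1..<l}" "y \<in> {1..<l}" "(t * x) mod l = (t * y) mod l"
    then have "[t * x = t * y] (mod l)" by (simp add: cong_def)
    moreover have "coprime t l" using nd[OF t] l by (simp add: coprime_commute prime_imp_coprime)
    ultimately have "[x = y] (mod l)" by (simp add: cong_mult_lcancel_nat)
    then show "x = y" using xy by (simp add: cong_less_modulus_unique_nat)
  qed
  moreover have "(\<lambda>u. (t * u) mod l) ` {1..<l} \<subseteq> {1..<l}"
  proof safe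
    fix u assume u: "u \<in> {1..<l}"
    have "\<not> l dvd t * u" using nd[OF t] nd[OF u] l by (simp add: prime_dvd_mult_iff)
    then have "t * u mod l \<noteq> 0" by (simp add: mod_eq_0_iff_dvd)
    then show "t * u mod l \<in> {1..<l}" using prime_gt_0_nat[OF l] by auto
  qed
  ultimately show ?thesis by (simp add: bij_betw_def endo_inj_surj)
qed

text \<open>The substitution \<open>u \<mapsto> t u\<close> permutes the nonzero residues. It makes
  the sum constant along a whole orbit of parameters, which is what turns a mean value into a
  pointwise bound.\<close>

lemma kloosterman_orbit:
  assumes l: "prime l" and t: "t \<in> {1..<l}"
  shows "kloosterman l i j (a * modular_inverse (int l) (int t) ^ i) (b * int t ^ j) = kloosterman l i j a b"
proof -
  let ?w = "\<lambda>u. modular_inverse (int l) (int u)"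
  have l0: "l > 0" using prime_gt_0_nat[OF l] .
  have "kloosterman l i j a b
      = (\<Sum>u\<in>{1..<l}. root_exp l (a * ?w ((t * u) mod l) ^ i + b * int ((t * u) mod l) ^ j))"
    unfolding kloosterman_def by (rule sum.reindex_bij_betw[OF bij_betw_mult_mod_prime[OF assms], symmetric])
  also have "\<dots> = kloosterman l i j (a * ?w t ^ i) (b * int t ^ j)"
    unfolding kloosterman_def
  proof (intro sum.cong refl root_exp_cong[OF l0] cong_add)
    fix u assume u: "u \<in> {1..<l}"
    have tu: "t * u mod l \<in> {1..<l}"
      using bij_betw_mult_mod_prime[OF assms] u by (auto simp: bij_betw_def)
    have c: "[int (t * u mod l) = int t * int u] (mod int l)"
      by (simp add: zmod_int)
    have "[int (t * u mod l) * ?w (t * u mod l) = 1] (mod int l)"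
      by (rule modular_inverse_cong_1[OF l tu])
    moreover have "[int (t * u mod l) * (?w t * ?w u) = 1] (mod int l)"
    proof -
      have "[int (t * u mod l) * (?w t * ?w u) = int t * int u * (?w t * ?w u)] (mod int l)"
        by (intro cong_mult c cong_refl)
      also have "int t * int u * (?w t * ?w u) = (int t * ?w t) * (int u * ?w u)" by simp
      also have "[\<dots> = 1 * 1] (mod int l)"
        by (intro cong_mult modular_inverse_cong_1 l t u)
      finally show ?thesis by simp
    qed
    ultimately have "[?w (t * u mod l) = ?w t * ?w u] (mod int l)"
      by (rule cong_inverse_unique)
    then have "[a * ?w (t * u mod l) ^ i = a * (?w t * ?w u) ^ i] (mod int l)"
      by (intro cong_mult cong_pow cong_refl)
    then show "[a * ?w (t * u mod l) ^ i = a * ?w t ^ i * ?w u ^ i] (mod int l)"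
      by (simp add: power_mult_distrib mult.assoc)
    have "[b * int (t * u mod l) ^ j = b * (int t * int u) ^ j] (mod int l)"
      by (intro cong_mult cong_pow cong_refl c)
    then show "[b * int (t * u mod l) ^ j = b * int t ^ j * int u ^ j] (mod int l)"
      by (simp add: power_mult_distrib mult.assoc)
  qed
  finally show ?thesis ..
qed

text \<open>The square of the sum is again an exponential sum, over pairs \<open>(x, y)\<close>. Its
  mean square over all parameters counts the additive quadruples.\<close>

lemma kloosterman_fourth_moment:
  assumes l: "prime l" and i: "i \<ge> 1" and j: "j \<ge> 1"
  shows "(\<Sum>a<l. \<Sum>b<l. norm (kloosterman l i j (int a) (int b)) ^ 4)
    \<le> real (2 * i * j ^ 2 + i ^ 2) * real l ^ 4"
proof -
  define w where "w = (\<lambda>u. modular_inverse (int l) (int u))"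
  define A where "A = {1..<l} \<times> {1..<l}"
  define \<phi> where "\<phi> = (\<lambda>(x, y). w x ^ i + w y ^ i)"
  define \<psi> where "\<psi> = (\<lambda>(x::nat, y::nat). int x ^ j + int y ^ j)"
  have "norm (kloosterman l i j (int a) (int b)) ^ 4
     = (norm (\<Sum>z\<in>A. root_exp l (int a * \<phi> z + int b * \<psi> z)))\<^sup>2" for a b
  proof -
    have "kloosterman l i j (int a) (int b) * kloosterman l i j (int a) (int b)
      = (\<Sum>x\<in>{1..<l}. \<Sum>y\<in>{1..<l}. root_exp l (int a * \<phi> (x, y) + int b * \<psi> (x, y)))"
      unfolding kloosterman_def sum_product root_exp_add[symmetric]
      by (intro sum.cong refl arg_cong[of _ _ "root_exp l"]) (simp add: \<phi>_def \<psi>_def w_def algebra_simps)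
    also have "\<dots> = (\<Sum>z\<in>A. root_exp l (int a * \<phi> z + int b * \<psi> z))"
      by (simp add: A_def sum.cartesian_product)
    finally have "norm (kloosterman l i j (int a) (int b)) * norm (kloosterman l i j (int a) (int b))
      = norm (\<Sum>z\<in>A. root_exp l (int a * \<phi> z + int b * \<psi> z))"
      by (metis norm_mult)
    then show ?thesis by (metis power2_eq_square power_mult numeral_Bit0 mult_2)
  qed
  then have "(\<Sum>a<l. \<Sum>b<l. norm (kloosterman l i j (int a) (int b)) ^ 4)
    = (\<Sum>a<l. \<Sum>b<l. (norm (\<Sum>z\<in>A. root_exp l (int a * \<phi> z + int b * \<psi> z)))\<^sup>2)" by simp
  also have "\<dots> = real l ^ 2 * real (card {(z, z') \<in> A \<times> A. [\<phi> z = \<phi> z'] (mod int l) \<and> [\<psi> z = \<psi> z'] (mod int l)})"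
    using prime_gt_0_nat[OF l] by (intro sum_norm_power2_root_exp) (auto simp: A_def)
  also have "\<dots> \<le> real l ^ 2 * real ((2 * i * j ^ 2 + i ^ 2) * l ^ 2)"
    unfolding A_def \<phi>_def \<psi>_def
    by (intro mult_left_mono of_nat_mono card_additive_quadruples l i j)
      (auto simp: w_def intro!: modular_inverse_cong_1[OF l, unfolded One_nat_def])
  also have "\<dots> = real (2 * i * j ^ 2 + i ^ 2) * real l ^ 4"
    by (simp add: power2_eq_square power4_eq_xxxx)
  finally show ?thesis .
qed

text \<open>The value at \<open>(a, b)\<close> recurs along its orbit of \<open>l - 1\<close> steps.
  As \<open>b\<close> is invertible, a parameter determines \<open>t^j\<close> and is met at most
  \<open>j\<close> times, so \<open>l - 1\<close> copies of the fourth power fit into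
  \<open>j\<close> times the fourth moment. The factor 2 pays for
  \<open>l \<le> 2 (l - 1)\<close>.\<close>

lemma kloosterman_bound:
  assumes l: "prime l" and i: "i \<ge> 1" and j: "j \<ge> 1" and b: "\<not> int l dvd b"
  shows "norm (kloosterman l i j a b) ^ 4 \<le> real (2 * j * (2 * i * j ^ 2 + i ^ 2)) * real l ^ 3"
proof -
  define H where "H = (\<lambda>(a, b). norm (kloosterman l i j (int a) (int b)) ^ 4)"
  define g where "g = (\<lambda>t. (nat ((a * modular_inverse (int l) (int t) ^ i) mod int l), nat ((b * int t ^ j) mod int l)))"
  define B where "B = {..<l} \<times> {..<l}"
  have l0: "l > 0" using prime_gt_0_nat[OF l] .
  have Hg: "H (g t) = norm (kloosterman l i j a b) ^ 4" if "t \<in> {1..<l}" for t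
  proof -
    have "kloosterman l i j (int (fst (g t))) (int (snd (g t)))
       = kloosterman l i j (a * modular_inverse (int l) (int t) ^ i) (b * int t ^ j)"
      using l0 by (intro kloosterman_cong) (auto simp: g_def)
    also have "\<dots> = kloosterman l i j a b" by (rule kloosterman_orbit[OF l that])
    finally show ?thesis by (simp add: H_def case_prod_unfold)
  qed
  have gB: "g ` {1..<l} \<subseteq> B" using l0 by (auto simp: g_def B_def nat_less_iff)
  have fibre: "card {t \<in> {1..<l}. g t = z} \<le> j" for z
  proof (cases "{t \<in> {1..<l}. g t = z} = {}")
    case False
    then obtain t0 where t0: "t0 \<in> {1..<l}" "g t0 = z" by auto
    have "{t \<in> {1..<l}. g t = z} \<subseteq> {x. x < l \<and> [int x ^ j = int t0 ^ j] (mod int l)}"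
    proof safe
      fix t assume t: "t \<in> {1..<l}" "z = g t"
      show "t < l" using t by auto
      have "nat ((b * int t ^ j) mod int l) = nat ((b * int t0 ^ j) mod int l)"
        using t t0 by (simp add: g_def)
      then have "[b * int t ^ j = b * int t0 ^ j] (mod int l)"
        using l0 by (simp add: cong_def eq_nat_nat_iff)
      moreover have "coprime b (int l)" 
        using prime_imp_coprime[of "int l" b] b l by (simp add: coprime_commute)
      ultimately show "[int t ^ j = int t0 ^ j] (mod int l)" by (simp add: cong_mult_lcancel)
    qed
    then have "card {t \<in> {1..<l}. g t = z} \<le> card {x. x < l \<and> [int x ^ j = int t0 ^ j] (mod int l)}"
      by (intro card_mono) auto
    then show ?thesis using card_power_roots_mod_prime[OF l j, of "int t0 ^ j"] by linarith
  next
    case True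
    then show ?thesis by (metis card.empty le0)
  qed
  have "real (l - 1) * norm (kloosterman l i j a b) ^ 4 = (\<Sum>t\<in>{1..<l}. H (g t))"
    using Hg by simp
  also have "\<dots> = (\<Sum>z\<in>B. \<Sum>t\<in>{t \<in> {1..<l}. g t = z}. H (g t))"
    using gB by (intro sum.group[symmetric]) (auto simp: B_def)
  also have "\<dots> = (\<Sum>z\<in>B. real (card {t \<in> {1..<l}. g t = z}) * H z)"
    by (intro sum.cong refl) simp
  also have "\<dots> \<le> (\<Sum>z\<in>B. real j * H z)"
    using fibre by (intro sum_mono mult_right_mono) (auto simp: H_def)
  also have "\<dots> = real j * (\<Sum>a<l. \<Sum>b<l. norm (kloosterman l i j (int a) (int b)) ^ 4)"
    by (simp add: B_def H_def sum.cartesian_product case_prod_unfold flip: sum_distrib_left)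
  also have "\<dots> \<le> real j * (real (2 * i * j ^ 2 + i ^ 2) * real l ^ 4)"
    by (intro mult_left_mono kloosterman_fourth_moment l i j) auto
  finally have main: "real (l - 1) * norm (kloosterman l i j a b) ^ 4
      \<le> real j * (real (2 * i * j ^ 2 + i ^ 2) * real l ^ 4)" .
  have "l \<le> 2 * (l - 1)" using prime_ge_2_nat[OF l] by simp
  then have "real l \<le> 2 * real (l - 1)" by (metis of_nat_le_iff of_nat_mult of_nat_numeral)
  then have "real l * norm (kloosterman l i j a b) ^ 4 \<le> 2 * real (l - 1) * norm (kloosterman l i j a b) ^ 4"
    by (intro mult_right_mono) auto
  also have "\<dots> \<le> 2 * (real j * (real (2 * i * j ^ 2 + i ^ 2) * real l ^ 4))"
    using main by simp
  also have "\<dots> = real l * (real (2 * j * (2 * i * j ^ 2 + i ^ 2)) * real l ^ 3)"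
    by (simp add: power4_eq_xxxx power3_eq_cube)
  finally show ?thesis using l0 by simp
qed

lemma root_exp_mult_cancel:
  assumes "n > 0"
  shows "root_exp (l * n) (int n * k) = root_exp l k"
  using assms by (simp add: root_exp_def)

text \<open>The residues \<open>p\<close> are grouped by their class modulo \<open>n\<close>. Within
  a class \<open>U p\<close> is constant modulo \<open>n\<close>, so the class sum is a unimodular
  constant times a Kloosterman sum modulo \<open>l\<close>, whose parameters are twisted by the
  inverse \<open>n'\<close> of \<open>n\<close>. The \<open>n\<close> classes are added
  trivially.\<close>

lemma rational_sum_bound:
  fixes U :: "nat \<Rightarrow> int" and A B :: int
  assumes l: "prime l" and n: "n > 0" "\<not> l dvd n" and i: "i \<ge> 1" and B: "\<not> int l dvd B"
    and M: "M \<ge> 0" "\<And>a b. \<not> int l dvd b \<Longrightarrow> norm (kloosterman l i j a b) \<le> M"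
    and q: "q = l * n"
    and U: "\<And>p. 0 < p \<Longrightarrow> p < q \<Longrightarrow> coprime p q \<Longrightarrow> [int p ^ i * U p = A + B * int p ^ (i + j)] (mod int q)"
  shows "norm (\<Sum>p\<in>{p. 0 < p \<and> p < q \<and> coprime p q}. root_exp q (U p)) \<le> real n * M"
proof -
  define T where "T = {p. 0 < p \<and> p < q \<and> coprime p q}"
  define C where "C = (\<lambda>v. {p \<in> T. p mod n = v})"
  let ?w = "\<lambda>u. modular_inverse (int l) (int u)"
  have l0: "l > 0" using prime_gt_0_nat[OF l] .
  have q0: "q > 0" using q l0 n by simp
  have finT: "finite T" by (auto simp: T_def)
  have cop_ln: "coprime l n" using l n by (simp add: prime_imp_coprime)
  obtain n' where n': "[int n * n' = 1] (mod int l)"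
    using cop_ln cong_solve_coprime_int[of "int n" "int l"] by (auto simp: coprime_commute)
  have n'B: "\<not> int l dvd n' * B"
  proof
    assume "int l dvd n' * B"
    then have "int l dvd n'" using B l by (simp add: prime_dvd_mult_iff)
    then have "int l dvd int n * n'" by simp
    with n' have "int l dvd 1" by (metis cong_dvd_iff)
    then show False using prime_gt_1_nat[OF l] by simp
  qed
  have part: "norm (\<Sum>p\<in>C v. root_exp q (U p)) \<le> M" for v
  proof (cases "C v = {}")
    case True
    then show ?thesis using M by simp
  next
    case False
    then obtain p0 where p0: "p0 \<in> C v" by auto
    define c where "c = root_exp q (U p0) * root_exp l (- (n' * U p0))"
    \<comment> \<open>By the Chinese remainder theorem a nonempty class meets each nonzero residue
      modulo \<open>l\<close> exactly once; \<open>v\<close> is coprime to \<open>n\<close> because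
      \<open>p0\<close> is.\<close>
    have bij: "bij_betw (\<lambda>p. p mod l) (C v) {1..<l}"
    proof (rule bij_betwI')
      fix x y assume xy: "x \<in> C v" "y \<in> C v"
      show "(x mod l = y mod l) = (x = y)"
      proof
        assume "x mod l = y mod l"
        then have "[x = y] (mod l)" "[x = y] (mod n)" using xy by (auto simp: C_def cong_def)
        then have "[x = y] (mod q)" unfolding q using cop_ln by (simp add: coprime_cong_mult_nat)
        then show "x = y" using xy by (auto simp: C_def T_def cong_less_modulus_unique_nat)
      qed simp
    next
      fix x assume "x \<in> C v"
      then have "coprime x l" by (auto simp: C_def T_def q)
      then have "\<not> l dvd x" using l by (metis coprime_absorb_right coprime_commute not_prime_unit)
      then have "x mod l \<noteq> 0" by (simp add: mod_eq_0_iff_dvd)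
      then show "x mod l \<in> {1..<l}" using l0 by auto
    next
      fix u assume u: "u \<in> {1..<l}"
      obtain x where x: "[x = u] (mod l)" "[x = v] (mod n)"
        using binary_chinese_remainder_nat[OF cop_ln, of u v] by auto
      define y where "y = x mod q"
      have y1: "[y = u] (mod l)" and y2: "[y = v] (mod n)"
        using x by (simp_all add: y_def q cong_def mod_mod_cancel)
      have vp: "[v = p0] (mod n)" and p0n: "coprime p0 n" using p0 by (auto simp: C_def T_def cong_def q)
      have "coprime y n" using y2 vp p0n by (metis cong_imp_coprime cong_sym)
      moreover have "\<not> l dvd u" using u by (auto dest: dvd_imp_le)
      then have "coprime u l" using l by (simp add: coprime_commute prime_imp_coprime)
      then have "coprime y l" using y1 by (metis cong_imp_coprime cong_sym)
      ultimately have cy: "coprime y q" by (simp add: q)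
      have yl: "y mod l = u" using y1 u by (simp add: cong_def)
      moreover have "y > 0" using yl u by (auto intro!: gr0I)
      moreover have "y < q" using q0 by (simp add: y_def)
      moreover have "y mod n = v" using y2 p0 by (auto simp: C_def cong_def)
      ultimately show "\<exists>x\<in>C v. u = x mod l" using cy by (auto simp: C_def T_def intro!: bexI[of _ y])
    qed
    have summand: "root_exp q (U p) = c * root_exp l (n' * A * ?w (p mod l) ^ i + n' * B * int (p mod l) ^ j)"
      if p: "p \<in> C v" for p
    proof -
      have Tp: "0 < p" "p < q" "coprime p q" and Tp0: "0 < p0" "p0 < q" "coprime p0 q"
        using p p0 by (auto simp: C_def T_def)
      have pp0: "[int p = int p0] (mod int n)"
        using p p0 by (simp add: C_def cong_int_iff) (simp add: cong_def)
      have Un: "[int x ^ i * U x = A + B * int x ^ (i + j)] (mod int n)"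
        and Ul: "[int x ^ i * U x = A + B * int x ^ (i + j)] (mod int l)"
        if "0 < x" "x < q" "coprime x q" for x
        using U[OF that] by (auto simp: q intro: cong_dvd_modulus)
      have "[int p0 ^ i * U p = int p0 ^ i * U p0] (mod int n)"
      proof -
        have "[int p0 ^ i * U p = int p ^ i * U p] (mod int n)"
          by (intro cong_mult cong_pow cong_refl cong_sym[OF pp0])
        also note Un[OF Tp]
        also have "[A + B * int p ^ (i + j) = A + B * int p0 ^ (i + j)] (mod int n)"
          by (intro cong_add cong_mult cong_pow cong_refl pp0)
        also note cong_sym[OF Un[OF Tp0]]
        finally show ?thesis .
      qed
      moreover have "coprime (int p0 ^ i) (int n)" using Tp0 by (simp add: q)
      ultimately have "[U p = U p0] (mod int n)" by (simp add: cong_mult_lcancel)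
      \<comment> \<open>Then \<open>U p / q = U p0 / q + k / l\<close>, and multiplication by
        \<open>n'\<close> recovers \<open>k\<close> modulo \<open>l\<close> from
        \<open>U p\<close>.\<close>
      then obtain k where k: "U p = U p0 + int n * k" by (metis cong_iff_lin cong_sym)
      have pl: "p mod l \<in> {1..<l}" using bij p by (auto simp: bij_betw_def)
      let ?u = "int (p mod l)"
      have pu: "[int p = ?u] (mod int l)" by (simp add: zmod_int)
      have wi: "[(int p * ?w (p mod l)) ^ i = 1] (mod int l)"
      proof -
        have "[(int p * ?w (p mod l)) ^ i = (?u * ?w (p mod l)) ^ i] (mod int l)"
          by (intro cong_pow cong_mult pu cong_refl)
        also have "[(?u * ?w (p mod l)) ^ i = 1 ^ i] (mod int l)"
          by (intro cong_pow modular_inverse_cong_1 l pl)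
        finally show ?thesis by simp
      qed
      have UP: "[U p = A * ?w (p mod l) ^ i + B * ?u ^ j] (mod int l)"
      proof -
        have "[1 * U p = (int p * ?w (p mod l)) ^ i * U p] (mod int l)"
          by (intro cong_mult cong_refl cong_sym[OF wi])
        also have "(int p * ?w (p mod l)) ^ i * U p = ?w (p mod l) ^ i * (int p ^ i * U p)"
          by (simp add: power_mult_distrib)
        also have "[\<dots> = ?w (p mod l) ^ i * (A + B * int p ^ (i + j))] (mod int l)"
          by (intro cong_mult cong_refl Ul Tp)
        also have "?w (p mod l) ^ i * (A + B * int p ^ (i + j))
            = A * ?w (p mod l) ^ i + B * int p ^ j * (int p * ?w (p mod l)) ^ i"
          by (simp add: power_mult_distrib power_add algebra_simps)
        also have "[\<dots> = A * ?w (p mod l) ^ i + B * ?u ^ j * 1] (mod int l)"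
          by (intro cong_add cong_mult cong_refl cong_pow wi pu)
        finally show ?thesis by simp
      qed
      have "[1 * k = (int n * n') * k] (mod int l)"
        by (intro cong_mult cong_refl cong_sym[OF n'])
      also have "(int n * n') * k = n' * (U p - U p0)" by (simp add: k)
      also have "[\<dots> = n' * (A * ?w (p mod l) ^ i + B * ?u ^ j - U p0)] (mod int l)"
        by (intro cong_mult cong_diff cong_refl UP)
      also have "n' * (A * ?w (p mod l) ^ i + B * ?u ^ j - U p0)
          = - (n' * U p0) + (n' * A * ?w (p mod l) ^ i + n' * B * ?u ^ j)"
        by (simp add: algebra_simps)
      finally have "root_exp l k = root_exp l (- (n' * U p0) + (n' * A * ?w (p mod l) ^ i + n' * B * ?u ^ j))"
        using l0 by (intro root_exp_cong) simp_all
      moreover have "root_exp q (U p) = root_exp q (U p0) * root_exp l k"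
        unfolding k root_exp_add q root_exp_mult_cancel[OF n(1)] ..
      ultimately show ?thesis unfolding c_def by (simp only: root_exp_add mult.assoc)
    qed
    have "(\<Sum>p\<in>C v. root_exp q (U p))
        = c * (\<Sum>p\<in>C v. root_exp l (n' * A * ?w (p mod l) ^ i + n' * B * int (p mod l) ^ j))"
      unfolding sum_distrib_left by (intro sum.cong refl summand)
    also have "\<dots> = c * kloosterman l i j (n' * A) (n' * B)"
      unfolding kloosterman_def sum.reindex_bij_betw[OF bij, symmetric] ..
    finally have "norm (\<Sum>p\<in>C v. root_exp q (U p)) = norm (kloosterman l i j (n' * A) (n' * B))"
      by (simp add: c_def norm_mult)
    then show ?thesis using M(2)[OF n'B] by simp
  qed
  have "(\<Sum>p\<in>T. root_exp q (U p)) = (\<Sum>v<n. \<Sum>p\<in>C v. root_exp q (U p))"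
    unfolding C_def using n by (intro sum.group[symmetric] finT) auto
  then have "norm (\<Sum>p\<in>T. root_exp q (U p)) \<le> (\<Sum>v<n. norm (\<Sum>p\<in>C v. root_exp q (U p)))"
    by (simp add: norm_sum)
  also have "\<dots> \<le> (\<Sum>v<n. M)" by (intro sum_mono part)
  finally show ?thesis by (simp add: T_def)
qed

section \<open>Counting moduli and coprime pairs\<close>

text \<open>Telescoping through \<open>1/(n+1)^2 \<le> 1/n - 1/(n+1)\<close>.\<close>

lemma sum_inverse_squares_le:
  assumes "K \<ge> 1" "K \<le> X"
  shows "(\<Sum>a\<in>{K<..X}. 1 / real a ^ 2) \<le> 1 / real K - 1 / real X"
  using assms(2)
proof (induction X rule: dec_induct)
  case (step n)
  have n: "real n > 0" using step assms(1) by simp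
  then have "1 / real (Suc n) ^ 2 \<le> 1 / (real n * real (Suc n))"
    unfolding power2_eq_square by (intro frac_le mult_right_mono) auto
  also have "\<dots> = 1 / real n - 1 / real (Suc n)" using n by (simp add: field_simps)
  finally have "1 / real (Suc n) ^ 2 \<le> 1 / real n - 1 / real (Suc n)" .
  moreover have "{K<..Suc n} = insert (Suc n) {K<..n}" using step by auto
  ultimately show ?case using step by simp
qed simp

lemma card_multiples_le:
  assumes "d > 0"
  shows "card {q. 0 < q \<and> q \<le> X \<and> d dvd q} \<le> X div (d::nat)"
proof -
  have "{q. 0 < q \<and> q \<le> X \<and> d dvd q} \<subseteq> (\<lambda>k. d * k) ` {1..X div d}"
  proof safe
    fix q assume "0 < q" "q \<le> X" "d dvd q"
    then show "q \<in> (\<lambda>k. d * k) ` {1..X div d}"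
      using assms by (auto elim!: dvdE simp: image_iff less_eq_div_iff_mult_less_eq mult.commute)
  qed
  then have "card {q. 0 < q \<and> q \<le> X \<and> d dvd q} \<le> card ((\<lambda>k. d * k) ` {1..X div d})"
    by (intro card_mono) auto
  also have "\<dots> \<le> X div d" using card_image_le[of "{1..X div d}" "\<lambda>k. d * k"] by simp
  finally show ?thesis .
qed

definition large_exact_prime :: "nat \<Rightarrow> nat \<Rightarrow> bool" where
  "large_exact_prime L q \<longleftrightarrow> (\<exists>l. prime l \<and> l > L \<and> l dvd q \<and> \<not> l\<^sup>2 dvd q)"

text \<open>In \<open>q = c a\<^sup>2\<close> with \<open>c\<close> squarefree, every prime factor of \<open>c\<close> beyond \<open>L\<close> also divides \<open>a\<close>.\<close>

lemma square_divisor_large: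
  assumes "q > 0" "\<not> large_exact_prime L q"
  shows "\<exists>a. a\<^sup>2 dvd q \<and> q \<le> fact L * a ^ 3"
proof -
  define a where "a = square_part q"
  define c where "c = squarefree_part q"
  have q: "q = c * a\<^sup>2" unfolding a_def c_def by (rule squarefree_decompose)
  have c0: "c \<noteq> 0" and a0: "a \<noteq> 0" using q assms by (auto intro: Nat.gr0I)
  have sqf: "squarefree c" using assms unfolding c_def by (simp add: squarefree_squarefree_part)
  \<comment> \<open>Since \<open>c\<close> is squarefree, it suffices that each of its primes
    divides \<open>fact L * a\<close>: primes up to \<open>L\<close> divide the factorial, and
    larger ones divide \<open>a\<close>.\<close>
  have "c dvd fact L * a"
  proof (rule multiplicity_le_imp_dvd[OF c0])
    fix l :: nat assume l: "prime l"
    show "multiplicity l c \<le> multiplicity l (fact L * a)"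
    proof (cases "l dvd c")
      case False
      then show ?thesis by (simp add: not_dvd_imp_multiplicity_0)
    next
      case True
      have "l dvd fact L * a"
      proof (cases "l \<le> L")
        case True
        then show ?thesis using l by (simp add: prime_dvd_fact_iff)
      next
        case False
        have "l dvd q" using True q by simp
        then have "l\<^sup>2 dvd q" using assms(2) l False by (auto simp: large_exact_prime_def)
        then show ?thesis by (simp add: a_def dvd_square_part_iff)
      qed
      moreover have "fact L * a \<noteq> 0" using a0 by simp
      ultimately have "multiplicity l (fact L * a) \<ge> 1"
        using l by (simp add: prime_multiplicity_gt_zero_iff Suc_le_eq)
      moreover have "multiplicity l c \<le> 1"
      proof -
        have "\<not> l\<^sup>2 dvd c" using sqf l squarefreeD[of c l] not_prime_unit by auto
        then show ?thesis using c0 l multiplicity_dvd'[of 2 l c] by (cases "multiplicity l c \<le> 1") auto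
      qed
      ultimately show ?thesis by linarith
    qed
  qed
  then have "c \<le> fact L * a" using a0 by (intro dvd_imp_le) auto
  then have "q \<le> fact L * a * a\<^sup>2" unfolding q by (rule mult_le_mono1)
  then have "q \<le> fact L * a ^ 3" by (simp add: power2_eq_square power3_eq_cube mult.assoc)
  moreover have "a\<^sup>2 dvd q" using q by simp
  ultimately show ?thesis by blast
qed

text \<open>Such a \<open>q\<close> is at most \<open>L! a^3\<close> for some \<open>a^2\<close>
  dividing it. If \<open>a \<le> K\<close>, then \<open>q \<le> L! K^3\<close>; if
  \<open>a > K\<close>, then \<open>q\<close> is a multiple of a large square, which happens at most
  \<open>X / K\<close> times. With \<open>L\<close> and \<open>K\<close> fixed the first term is
  bounded in \<open>X\<close>.\<close>

lemma card_no_large_exact_prime: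
  assumes "K \<ge> 1"
  shows "real (card {q. 0 < q \<and> q \<le> X \<and> \<not> large_exact_prime L q}) \<le> real (fact L * K ^ 3) + real X / real K"
proof -
  let ?S = "{q. 0 < q \<and> q \<le> X \<and> \<not> large_exact_prime L q}"
  let ?T = "\<lambda>a. {q. 0 < q \<and> q \<le> X \<and> a\<^sup>2 dvd q}"
  have "?S \<subseteq> {1..fact L * K ^ 3} \<union> (\<Union>a\<in>{K<..X}. ?T a)"
  proof
    fix q assume q: "q \<in> ?S"
    then obtain a where a: "a\<^sup>2 dvd q" "q \<le> fact L * a ^ 3" using square_divisor_large[of q L] by auto
    show "q \<in> {1..fact L * K ^ 3} \<union> (\<Union>a\<in>{K<..X}. ?T a)"
    proof (cases "a \<le> K")
      case True
      then have "fact L * a ^ 3 \<le> fact L * K ^ 3" by (intro mult_le_mono power_mono) auto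
      then have "q \<le> fact L * K ^ 3" using a(2) by linarith
      then show ?thesis using q by auto
    next
      case False
      have "a \<le> a\<^sup>2" by (simp add: power2_eq_square)
      also have "\<dots> \<le> q" using a q by (intro dvd_imp_le) auto
      finally show ?thesis using a q False by auto
    qed
  qed
  then have "card ?S \<le> card ({1..fact L * K ^ 3} \<union> (\<Union>a\<in>{K<..X}. ?T a))"
    by (intro card_mono) auto
  also have "\<dots> \<le> fact L * K ^ 3 + card (\<Union>a\<in>{K<..X}. ?T a)"
    by (rule order_trans[OF card_Un_le]) simp
  also have "\<dots> \<le> fact L * K ^ 3 + (\<Sum>a\<in>{K<..X}. card (?T a))"
    by (intro add_left_mono card_UN_le) auto
  also have "\<dots> \<le> fact L * K ^ 3 + (\<Sum>a\<in>{K<..X}. X div a\<^sup>2)"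
    by (intro add_left_mono sum_mono card_multiples_le) auto
  finally have "real (card ?S) \<le> real (fact L * K ^ 3 + (\<Sum>a\<in>{K<..X}. X div a\<^sup>2))"
    by (simp only: of_nat_le_iff)
  also have "\<dots> = real (fact L * K ^ 3) + (\<Sum>a\<in>{K<..X}. real (X div a\<^sup>2))" by simp
  also have "(\<Sum>a\<in>{K<..X}. real (X div a\<^sup>2)) \<le> (\<Sum>a\<in>{K<..X}. real X * (1 / real a ^ 2))"
  proof (intro sum_mono)
    fix a
    have "real (X div a\<^sup>2) \<le> real X / real (a\<^sup>2)" by (rule of_nat_div_le_of_nat)
    then show "real (X div a\<^sup>2) \<le> real X * (1 / real a ^ 2)" by simp
  qed
  also have "\<dots> = real X * (\<Sum>a\<in>{K<..X}. 1 / real a ^ 2)" by (simp add: sum_distrib_left)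
  also have "\<dots> \<le> real X * (1 / real K)"
  proof (intro mult_left_mono)
    show "(\<Sum>a\<in>{K<..X}. 1 / real a ^ 2) \<le> 1 / real K"
    proof (cases "K \<le> X")
      case True
      have "1 / real X \<ge> 0" by simp
      then show ?thesis using sum_inverse_squares_le[OF assms True] by linarith
    qed simp
  qed simp
  finally show ?thesis by simp
qed

section \<open>A quadratic lower bound for the number of coprime pairs\<close>

lemma card_pairs: "real (card {(p, q). 0 < p \<and> p < q \<and> q \<le> (X::nat)}) = real X * (real X - 1) / 2"
proof -
  have "{(p, q). 0 < p \<and> p < q \<and> q \<le> X} = prod.swap ` (SIGMA q:{..X}. {1..<q})"
    by (force simp: image_iff)
  then have "card {(p, q). 0 < p \<and> p < q \<and> q \<le> X} = card (SIGMA q:{..X}. {1..<q})"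
    by (simp add: card_image inj_on_def)
  also have "\<dots> = (\<Sum>q\<le>X. q - 1)" by (simp add: card_SigmaI)
  also have "real \<dots> = real X * (real X - 1) / 2"
    by (induction X) (auto simp: field_simps)
  finally show ?thesis .
qed

text \<open>A pair with gcd \<open>d > 1\<close> is \<open>d\<close> times a pair bounded by
  \<open>X / d\<close>. The squares \<open>1 / d^2\<close> with \<open>d \<ge> 2\<close> sum to at
  most \<open>1/4 + 1/2\<close>, so about a quarter of the roughly \<open>X^2 / 2\<close> pairs
  survives.\<close>

lemma card_coprime_pairs_ge:
  assumes "X \<ge> 2"
  shows "real (card {(p, q). coprime p q \<and> 0 < p \<and> p < q \<and> q \<le> (X::nat)}) \<ge> real X ^ 2 / 8 - real X / 2"
proof -
  let ?P = "\<lambda>X. {(p, q). 0 < p \<and> p < q \<and> q \<le> (X::nat)}"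
  let ?C = "{(p, q). coprime p q \<and> 0 < p \<and> p < q \<and> q \<le> (X::nat)}"
  let ?D = "\<lambda>d. (\<lambda>(p, q). (d * p, d * q)) ` ?P (X div d)"
  have fin: "finite (?P Y)" for Y
    by (rule finite_subset[of _ "{..Y} \<times> {..Y}"]) auto
  have finC: "finite ?C" by (rule finite_subset[OF _ fin[of X]]) auto
  have "?P X \<subseteq> ?C \<union> (\<Union>d\<in>{1<..X}. ?D d)"
  proof safe
    fix p q :: nat
    assume pq: "0 < p" "p < q" "q \<le> X" and nin: "(p, q) \<notin> (\<Union>d\<in>{1<..X}. ?D d)"
    show "coprime p q"
    proof (rule ccontr)
      assume "\<not> coprime p q"
      define d where "d = gcd p q"
      have d1: "d \<noteq> 1" using \<open>\<not> coprime p q\<close> by (simp add: d_def coprime_iff_gcd_eq_1)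
      have d0: "d > 0" using pq by (simp add: d_def)
      have "d \<le> q" using pq by (auto simp: d_def intro!: dvd_imp_le)
      then have d: "d \<in> {1<..X}" using d0 d1 pq by auto
      obtain p' q' where p'q': "p = d * p'" "q = d * q'" unfolding d_def by (meson gcd_dvd1 gcd_dvd2 dvdE)
      then have "0 < p'" "p' < q'" "q' \<le> X div d"
        using pq d0 by (auto simp: less_eq_div_iff_mult_less_eq mult.commute)
      then have "(p', q') \<in> ?P (X div d)" by simp
      then have "(p, q) \<in> ?D d" using p'q' by force
      then show False using nin d by blast
    qed
  qed
  then have "card (?P X) \<le> card (?C \<union> (\<Union>d\<in>{1<..X}. ?D d))"
    using fin finC by (intro card_mono) auto
  also have "\<dots> \<le> card ?C + card (\<Union>d\<in>{1<..X}. ?D d)" by (rule card_Un_le)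
  also have "card (\<Union>d\<in>{1<..X}. ?D d) \<le> (\<Sum>d\<in>{1<..X}. card (?D d))" by (intro card_UN_le) auto
  also have "\<dots> \<le> (\<Sum>d\<in>{1<..X}. card (?P (X div d)))"
    by (intro sum_mono card_image_le fin)
  finally have "real (card (?P X)) \<le> real (card ?C + (\<Sum>d\<in>{1<..X}. card (?P (X div d))))"
    by (simp only: of_nat_le_iff add_left_mono)
  then have "real X * (real X - 1) / 2
      \<le> real (card ?C) + (\<Sum>d\<in>{1<..X}. real (X div d) * (real (X div d) - 1) / 2)"
    by (simp only: of_nat_add of_nat_sum card_pairs)
  also have "(\<Sum>d\<in>{1<..X}. real (X div d) * (real (X div d) - 1) / 2) \<le> (\<Sum>d\<in>{1<..X}. real X ^ 2 / 2 * (1 / real d ^ 2))"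
  proof (intro sum_mono)
    fix d
    have "real (X div d) * (real (X div d) - 1) \<le> real (X div d) * real (X div d)"
      by (intro mult_left_mono) auto
    also have "\<dots> \<le> (real X / real d) * (real X / real d)"
      by (intro mult_mono of_nat_div_le_of_nat) auto
    finally show "real (X div d) * (real (X div d) - 1) / 2 \<le> real X ^ 2 / 2 * (1 / real d ^ 2)"
      by (simp add: power2_eq_square)
  qed
  also have "\<dots> = real X ^ 2 / 2 * (\<Sum>d\<in>{1<..X}. 1 / real d ^ 2)" by (simp add: sum_distrib_left)
  also have "\<dots> \<le> real X ^ 2 / 2 * (3 / 4)"
  proof (intro mult_left_mono)
    have "{1<..X} = insert 2 {2<..X}" using assms by auto
    then have "(\<Sum>d\<in>{1<..X}. 1 / real d ^ 2) = 1 / 4 + (\<Sum>d\<in>{2<..X}. 1 / real d ^ 2)" by simp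
    moreover have "1 / real X \<ge> 0" by simp
    moreover have "(\<Sum>d\<in>{2<..X}. 1 / real d ^ 2) \<le> 1 / 2 - 1 / real X"
      using sum_inverse_squares_le[of 2 X] assms by simp
    ultimately show "(\<Sum>d\<in>{1<..X}. 1 / real d ^ 2) \<le> 3 / 4" by linarith
  qed simp
  finally show ?thesis by (simp add: field_simps power2_eq_square)
qed

section \<open>Equidistribution\<close>

text \<open>The inner sum of the theorem, kept in the same syntactic form so that unfolding it
  restores the statement.\<close>

definition dedekind_exp_sum :: "nat \<Rightarrow> nat \<Rightarrow> int \<Rightarrow> nat \<Rightarrow> complex" where
  "dedekind_exp_sum i j m q = (\<Sum>p\<in>{p::nat. 0 < p \<and> p < q \<and> coprime p q}.
     exp (2 * complex_of_real pi * \<i> * of_int m * of_int (R_const i j) *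
          of_nat q ^ (i + j - 2) * complex_of_real (dedekind_sum i j p q)))"

lemma norm_dedekind_exp_sum_le: "norm (dedekind_exp_sum i j m q) \<le> real q"
proof -
  have unit: "norm (exp (2 * complex_of_real pi * \<i> * of_int m * of_int (R_const i j) *
          of_nat q ^ (i + j - 2) * complex_of_real (dedekind_sum i j p q))) = 1" for p
  proof -
    have "2 * complex_of_real pi * \<i> * of_int m * of_int (R_const i j) *
          of_nat q ^ (i + j - 2) * complex_of_real (dedekind_sum i j p q)
        = \<i> * complex_of_real (2 * pi * of_int m * of_int (R_const i j) * real q ^ (i + j - 2) * dedekind_sum i j p q)"
      by simp
    then show ?thesis by (simp only: norm_exp_i_times)
  qed
  have "norm (dedekind_exp_sum i j m q) \<le> (\<Sum>p\<in>{p::nat. 0 < p \<and> p < q \<and> coprime p q}. 1)"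
    unfolding dedekind_exp_sum_def by (rule sum_norm_le) (simp only: unit order_refl)
  also have "\<dots> = real (card {p::nat. 0 < p \<and> p < q \<and> coprime p q})" by simp
  also have "\<dots> \<le> real (card {..<q})" by (intro of_nat_mono card_mono) auto
  finally show ?thesis by simp
qed

lemma dedekind_exp_sum_small:
  assumes i: "i \<ge> 1" and j: "j \<ge> 1" and ev: "even (i + j)" and m: "m \<noteq> 0" and \<epsilon>: "\<epsilon> > 0"
  shows "\<exists>L. \<forall>q. large_exact_prime L q \<longrightarrow> norm (dedekind_exp_sum i j m q) \<le> \<epsilon> * real q"
proof -
  define A where "A = m * (scaled_bernoulli (i + j) * int ((i + j - 1) choose i))"
  define B where "B = m * (scaled_bernoulli (i + j) * int ((i + j - 1) choose j))"
  define K where "K = real (2 * j * (2 * i * j ^ 2 + i ^ 2))"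
  have "(i + j - 1) choose j \<noteq> 0" using i j by (simp add: binomial_eq_0_iff)
  then have B0: "B \<noteq> 0"
    using m scaled_bernoulli_nonzero[OF ev] i by (simp add: B_def)
  \<comment> \<open>A prime beyond \<open>\<bar>B\<bar>\<close> cannot divide the nonzero
    \<open>B\<close>, and beyond \<open>K / \<epsilon>^4\<close> the bound \<open>K l^3\<close> for
    the fourth power is at most \<open>(\<epsilon> l)^4\<close>.\<close>
  define L where "L = nat (max \<bar>B\<bar> \<lceil>K / \<epsilon> ^ 4\<rceil>)"
  have "norm (dedekind_exp_sum i j m q) \<le> \<epsilon> * real q" if "large_exact_prime L q" for q
  proof (cases "q = 0")
    case True
    then show ?thesis by (simp add: dedekind_exp_sum_def)
  next
    case False
    from that obtain l where l: "prime l" "l > L" "l dvd q" "\<not> l\<^sup>2 dvd q"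
      by (auto simp: large_exact_prime_def)
    obtain n where n: "q = l * n" using l by (elim dvdE)
    have n0: "n > 0" using n False by (auto intro: Nat.gr0I)
    have ln: "\<not> l dvd n" using l(4) by (auto simp: n power2_eq_square mult_dvd_mono)
    have lB: "\<not> int l dvd B"
    proof
      assume "int l dvd B"
      then have "int l \<le> \<bar>B\<bar>" using B0 by (metis abs_of_nat dvd_imp_le_int)
      then show False using l(2) by (simp add: L_def nat_less_iff)
    qed
    have lK: "K \<le> \<epsilon> ^ 4 * real l"
    proof -
      have "\<lceil>K / \<epsilon> ^ 4\<rceil> \<le> int L" unfolding L_def by linarith
      then have "K / \<epsilon> ^ 4 \<le> real L" by (simp add: ceiling_le_iff)
      also have "\<dots> \<le> real l" using l(2) by simp
      finally show ?thesis using \<epsilon> by (simp add: field_simps)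
    qed
    have bound: "norm (kloosterman l i j a b) \<le> \<epsilon> * real l" if "\<not> int l dvd b" for a b
    proof -
      have "norm (kloosterman l i j a b) ^ 4 \<le> K * real l ^ 3"
        unfolding K_def by (rule kloosterman_bound[OF l(1) i j that])
      also have "\<dots> \<le> \<epsilon> ^ 4 * real l * real l ^ 3" by (intro mult_right_mono lK) simp
      also have "\<dots> = (\<epsilon> * real l) ^ 4" by (simp add: power_mult_distrib power4_eq_xxxx power3_eq_cube)
      finally have "norm (kloosterman l i j a b) ^ Suc 3 \<le> (\<epsilon> * real l) ^ Suc 3" by simp
      then show ?thesis by (rule power_le_imp_le_base) (use \<epsilon> in simp)
    qed
    have "\<exists>u::int. of_int (R_const i j) * real q ^ (i + j - 2) * dedekind_sum i j p q = of_int u / real q \<and>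
       [int p ^ i * u = scaled_bernoulli (i + j) * (int ((i + j - 1) choose j) * int p ^ (i + j)
        + int ((i + j - 1) choose i))] (mod int q)" if "0 < p" "coprime p q" for p
      using scaled_dedekind_cong[OF i j ev that(1) _ that(2)] False by (metis bot_nat_0.not_eq_extremum)
    then obtain u where u1: "of_int (R_const i j) * real q ^ (i + j - 2) * dedekind_sum i j p q = of_int (u p) / real q"
       and u2: "[int p ^ i * u p = scaled_bernoulli (i + j) * (int ((i + j - 1) choose j) * int p ^ (i + j)
        + int ((i + j - 1) choose i))] (mod int q)" if "0 < p" "coprime p q" for p
      by metis
    have "dedekind_exp_sum i j m q = (\<Sum>p\<in>{p. 0 < p \<and> p < q \<and> coprime p q}. root_exp q (m * u p))"
      unfolding dedekind_exp_sum_def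
    proof (intro sum.cong refl)
      fix p assume p: "p \<in> {p. 0 < p \<and> p < q \<and> coprime p q}"
      have "2 * complex_of_real pi * \<i> * of_int m * of_int (R_const i j) *
          of_nat q ^ (i + j - 2) * complex_of_real (dedekind_sum i j p q)
        = \<i> * complex_of_real (2 * pi * of_int m * (of_int (R_const i j) * real q ^ (i + j - 2) * dedekind_sum i j p q))"
        by simp
      also have "\<dots> = \<i> * complex_of_real (2 * pi * (of_int (m * u p) / real q))"
        using u1[of p] p by simp
      finally show "exp (2 * complex_of_real pi * \<i> * of_int m * of_int (R_const i j) *
          of_nat q ^ (i + j - 2) * complex_of_real (dedekind_sum i j p q)) = root_exp q (m * u p)"
        by (simp only: root_exp_def cis_conv_exp)
    qed
    also have "norm \<dots> \<le> real n * (\<epsilon> * real l)"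
    proof (rule rational_sum_bound[OF l(1) n0 ln i lB _ bound n])
      fix p assume p: "0 < p" "p < q" "coprime p q"
      have "[m * (int p ^ i * u p) = m * (scaled_bernoulli (i + j) * (int ((i + j - 1) choose j) * int p ^ (i + j)
        + int ((i + j - 1) choose i)))] (mod int q)"
        by (intro cong_mult cong_refl u2 p)
      then show "[int p ^ i * (m * u p) = A + B * int p ^ (i + j)] (mod int q)"
        by (simp add: A_def B_def algebra_simps)
    qed (use \<epsilon> in auto)
    also have "\<dots> = \<epsilon> * real q" by (simp add: n)
    finally show ?thesis .
  qed
  then show ?thesis by blast
qed

theorem theorem1p3:
  fixes i j :: nat and m :: int
  assumes "i \<ge> 1" and "j \<ge> 1" and "even (i + j)" and "m \<noteq> 0"
  shows "((\<lambda>x::real.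
            1 / of_nat (card {(p::nat, q::nat). coprime p q \<and> 0 < p \<and> p < q \<and> real q \<le> x}) *
            (\<Sum>q\<in>{q::nat. 0 < q \<and> real q < x}. \<Sum>p\<in>{p::nat. 0 < p \<and> p < q \<and> coprime p q}.
               exp (2 * complex_of_real pi * \<i> * of_int m * of_int (R_const i j) *
                    of_nat q ^ (i + j - 2) * complex_of_real (dedekind_sum i j p q))))
          \<longlongrightarrow> 0) at_top"
proof (rule tendstoI)
  fix e :: real assume e: "e > 0"
  \<comment> \<open>The good moduli and the density of the bad ones cost
    \<open>2 \<epsilon> X^2 = e X^2 / 32\<close>. This is half of \<open>e X^2 / 16\<close>, the
    guaranteed size of \<open>e\<close> times the number of pairs; the other half is reserved for
    \<open>X D\<close>.\<close>
  define \<epsilon> where "\<epsilon> = e / 64"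
  have \<epsilon>: "\<epsilon> > 0" using e by (simp add: \<epsilon>_def)
  obtain L where L: "\<And>q. large_exact_prime L q \<Longrightarrow> norm (dedekind_exp_sum i j m q) \<le> \<epsilon> * real q"
    using dedekind_exp_sum_small[OF assms \<epsilon>] by blast
  define K where "K = Suc (nat \<lceil>1 / \<epsilon>\<rceil>)"
  have K1: "K \<ge> 1" by (simp add: K_def)
  have K\<epsilon>: "1 / real K \<le> \<epsilon>"
  proof -
    have "1 / \<epsilon> \<le> real K" unfolding K_def by linarith
    then show ?thesis using \<epsilon> K1 by (simp add: field_simps)
  qed
  define D where "D = real (fact L * K ^ 3)"
  \<comment> \<open>The 9 ensures \<open>X \<ge> 8\<close>, hence
    \<open>X / 2 \<le> X^2 / 16\<close> in the count of pairs; the second bound ensures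
    \<open>X D < e X^2 / 32\<close>.\<close>
  have "eventually (\<lambda>x::real. x \<ge> max 9 (32 * D / e + 2)) at_top" by (rule eventually_ge_at_top)
  then show "eventually (\<lambda>x. dist (1 / of_nat (card {(p::nat, q::nat). coprime p q \<and> 0 < p \<and> p < q \<and> real q \<le> x}) *
            (\<Sum>q\<in>{q::nat. 0 < q \<and> real q < x}. \<Sum>p\<in>{p::nat. 0 < p \<and> p < q \<and> coprime p q}.
               exp (2 * complex_of_real pi * \<i> * of_int m * of_int (R_const i j) *
                    of_nat q ^ (i + j - 2) * complex_of_real (dedekind_sum i j p q)))) 0 < e) at_top"
  proof eventually_elim
    case (elim x)
    define X where "X = nat \<lfloor>x\<rfloor>"
    have X_iff: "real q \<le> x \<longleftrightarrow> q \<le> X" for q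
      using elim by (simp add: X_def le_nat_floor le_nat_iff le_floor_iff)
    have X8: "X \<ge> 8" using X_iff[of 8] elim by simp
    have XD: "real X > 32 * D / e"
      using elim floor_correct[of x] unfolding X_def by simp linarith
    define S where "S = (\<Sum>q\<in>{q::nat. 0 < q \<and> real q < x}. dedekind_exp_sum i j m q)"
    define c where "c = card {(p::nat, q::nat). coprime p q \<and> 0 < p \<and> p < q \<and> real q \<le> x}"
    let ?bad = "{q. 0 < q \<and> q \<le> X \<and> \<not> large_exact_prime L q}"
    have "norm S \<le> (\<Sum>q\<in>{q::nat. 0 < q \<and> real q < x}. norm (dedekind_exp_sum i j m q))"
      unfolding S_def by (rule norm_sum)
    also have "\<dots> \<le> (\<Sum>q\<in>{1..X}. norm (dedekind_exp_sum i j m q))"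
      by (intro sum_mono2) (auto simp flip: X_iff)
    \<comment> \<open>Moduli with a large exact prime factor get the saving
      \<open>\<epsilon>\<close>, the rare others the trivial bound.\<close>
    also have "\<dots> \<le> (\<Sum>q\<in>{1..X}. \<epsilon> * real X + (if q \<in> ?bad then real X else 0))"
    proof (intro sum_mono)
      fix q assume q: "q \<in> {1..X}"
      show "norm (dedekind_exp_sum i j m q) \<le> \<epsilon> * real X + (if q \<in> ?bad then real X else 0)"
      proof (cases "large_exact_prime L q")
        case True
        have "\<epsilon> * real q \<le> \<epsilon> * real X" using q \<epsilon> by simp
        then show ?thesis using L[OF True] True by simp
      next
        case False
        have "0 \<le> \<epsilon> * real X" using \<epsilon> by simp
        moreover have "real q \<le> real X" using q by simp
        ultimately show ?thesis using norm_dedekind_exp_sum_le[of i j m q] False q by simp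
      qed
    qed
    also have "\<dots> = \<epsilon> * real X * real X + real X * real (card ?bad)"
    proof -
      have "(\<Sum>q\<in>{1..X}. if q \<in> ?bad then real X else 0) = (\<Sum>q\<in>?bad. real X)"
        by (intro sum.mono_neutral_cong_right) auto
      then show ?thesis by (simp add: sum.distrib mult_ac)
    qed
    also have "\<dots> \<le> \<epsilon> * real X * real X + real X * (D + real X * \<epsilon>)"
    proof (intro add_left_mono mult_left_mono)
      have "real X * (1 / real K) \<le> real X * \<epsilon>" by (intro mult_left_mono K\<epsilon>) simp
      then show "real (card ?bad) \<le> D + real X * \<epsilon>"
        using card_no_large_exact_prime[OF K1, of X L] unfolding D_def by simp
    qed simp
    also have "\<dots> = real X ^ 2 * (2 * \<epsilon>) + real X * D" by (simp add: algebra_simps power2_eq_square)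
    finally have S: "norm S \<le> real X ^ 2 * (2 * \<epsilon>) + real X * D" .
    have "real c \<ge> real X ^ 2 / 8 - real X / 2"
      unfolding c_def X_iff using X8 by (intro card_coprime_pairs_ge) simp
    moreover have "real X ^ 2 \<ge> 8 * real X" using X8 by (simp add: power2_eq_square mult_right_mono)
    ultimately have c: "real c \<ge> real X ^ 2 / 16" by simp
    have Xpos: "real X > 0" using X8 by simp
    then have "real X ^ 2 / 16 > 0" by simp
    then have cpos: "real c > 0" using c by linarith
    have "norm S < e * real c"
    proof -
      have "32 * D < real X * e" using XD e by (simp add: field_simps)
      then have "real X * (32 * D) < real X * (real X * e)" using Xpos by (rule mult_strict_left_mono)
      then have "real X ^ 2 * (2 * \<epsilon>) + real X * D < e * (real X ^ 2 / 16)"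
        by (simp add: \<epsilon>_def power2_eq_square algebra_simps)
      also have "\<dots> \<le> e * real c" using e c by (intro mult_left_mono) auto
      finally show ?thesis using S by simp
    qed
    then have "norm (1 / of_nat c * S) < e" using cpos by (simp add: norm_mult norm_divide field_simps)
    then show ?case unfolding S_def c_def dedekind_exp_sum_def by simp
  qed
qed

end
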